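(* Let $(X,d)$ be a quasi-metric space with triangle constant $K$ that is $\alpha$-Ahlfors with measure $\mu$. Let $\{F_1,\dots,F_H\}$ be a family of pairwise disjoint closed and bounded subsets of $X$ such that $(F_i,d)$ is locally $s_i$-Ahlfors with measure $\nu_i$, where $0\le s_i<\alpha$ for $i=1,\dots,H$. Set $F=\bigcup_{i=1}^H F_i$ and $\nu=\sum_{i=1}^H\nu_i$. Then there exist pairwise disjoint open sets $U_1,\dots,U_H$ with $F_i\subseteq U_i$ such that (0) for $x$ with $d(x,F)<2K\,\mathrm{diam}(F)$: $M_\mu\nu(x)\simeq d(x,F_i)^{s_i-\alpha}$ for every $x\in U_i\setminus F_i$ and every $i$, and $M_\mu\nu(x)\simeq1$ for every $x\notin\bigcup_{i=1}^H U_i$; while for $x$ with $d(x,F)\ge 2K\,\mathrm{diam}(F)$: $M_\mu\nu(x)\simeq d(x,F)^{-\alpha}\simeq d(x,x_0)^{-\alpha}$ for every $x_0\in F$; and for these sets: (1) for every $0\le\gamma<1$ the function $$w(x)=\begin{cases} d(x,F_i)^{(s_i-\alpha)\gamma}, & x\in U_i,\ i=1,\dots,H,\\ 1,& x\notin\bigcup_{i=1}^H U_i\end{cases}$$ belongs to $A_1(X,d,\mu)$; (2) for every $1<p<\infty$ and all real $\beta_1,\dots,\beta_H$ with $-(\alpha-s_i)<\beta_i<(\alpha-s_i)(p-1)$ for each $i$, the function $$v(x)=\begin{cases} d(x,F_i)^{\beta_i}, & x\in U_i,\ i=1,\dots,H,\\ 1,& x\notin\bigcup_{i=1}^H U_i\end{cases}$$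 belongs to $A_p(X,d,\mu)$.
   Context: A quasi-distance on a set $X$ is a non-negative symmetric function $d$ on $X\times X$ with $d(x,y)=0$ iff $x=y$ and $d(x,y)\le K(d(x,z)+d(z,y))$ for all $x,y,z$, for some constant $K\ge1$ (the triangle constant). Balls are $B(x,r)=\{y\in X: d(x,y)<r\}$; they generate the topology of $X$, and it is assumed throughout that all balls are open sets. $\mathrm{diam}(E)=\sup\{d(x,y):x,y\in E\}$ and $d(x,E)=\inf\{d(x,y):y\in E\}$. A subspace $(Y,d)$ of a quasi-metric space $(X,d)$ is $\alpha$-Ahlfors with measure $\mu$ if $\mu$ is a (non-negative) Borel measure supported in $Y$, finite on balls, and there is a constant $c\ge1$ with $c^{-1}r^\alpha\le\mu(B(x,r))\le c\,r^\alpha$ for every $x\in Y$ and every $0<r<\mathrm{diam}(Y)$. It is locally $\alpha$-Ahlfors with measure $\mu$ if these inequalities hold for every $x\in Y$ and every $0<r<r_0$, for some $r_0>0$. The ambient $\alpha$-Ahlfors space $(X,d)$ with measure $\mu$ is regarded as a non-atomic space of homogeneous type (i.e. $0<\mu(B(x,2r))\le A\mu(B(x,r))<\infty$ for all $x,r$, and points have measure zero). $M_\mu\nu(x)=\sup_{r>0}\nu(B(x,r))/\mu(B(x,r))$ for a non-negative Borel measure $\nu$ finite on balls. $f(x)\simeq g(x)$ means there are constants $0<k_1,k_2<\infty$, independent of $x$, with $k_1g(x)\le f(x)\le k_2g(x)$ for all $x$ in the indicated set. A weight $w$ on $X$ is a non-negative function that is $\mu$-integrable over every ball. For $1<p<\infty$,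 $w\in A_p(X,d,\mu)$ means there is $C$ with $\left(\frac1{\mu(B)}\int_B w\,d\mu\right)\left(\frac1{\mu(B)}\int_B w^{-1/(p-1)}\,d\mu\right)^{p-1}\le C$ for every ball $B$; $w\in A_1(X,d,\mu)$ means there is $C$ with $\frac1{\mu(B)}\int_B w\,d\mu\le C\,w(x)$ for every ball $B$ and $\mu$-almost every $x\in B$.
   Formalization: The formal theorem also assumes that distinct sets F_i and F_j lie at positive distance from each other; without this the claim fails, e.g. in the plane minus the origin with F_1=(0,1]×{0} and F_2={0}×(0,1]. It is automatic when closed bounded sets are compact. *)

theory Defs
  imports "HOL-Analysis.Analysis"
begin

text \<open>The underlying set of the quasi-metric space is the type \<open>'a\<close>.\<close>

definition quasi_metric :: "real \<Rightarrow> ('a \<Rightarrow> 'a \<Rightarrow> real) \<Rightarrow> bool" where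
  "quasi_metric K d \<longleftrightarrow>
     (\<forall>x y. 0 \<le> d x y) \<and> (\<forall>x y. d x y = d y x) \<and> (\<forall>x y. d x y = 0 \<longleftrightarrow> x = y) \<and>
     1 \<le> K \<and> (\<forall>x y z. d x y \<le> K * (d x z + d z y))"

definition qball :: "('a \<Rightarrow> 'a \<Rightarrow> real) \<Rightarrow> 'a \<Rightarrow> real \<Rightarrow> 'a set" where
  "qball d x r = {y. d x y < r}"

definition qtop :: "('a \<Rightarrow> 'a \<Rightarrow> real) \<Rightarrow> 'a topology" where
  "qtop d = topology (\<lambda>U. \<forall>x\<in>U. \<exists>r>0. qball d x r \<subseteq> U)"

lemma openin_qtop: "openin (qtop d) U \<longleftrightarrow> (\<forall>x\<in>U. \<exists>r>0. qball d x r \<subseteq> U)"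
proof -
  have "istopology (\<lambda>U. \<forall>x\<in>U. \<exists>r>0. qball d x r \<subseteq> U)"
    unfolding istopology_def
  proof (intro conjI allI impI ballI)
    fix S T x
    assume S: "\<forall>x\<in>S. \<exists>r>0. qball d x r \<subseteq> S" and T: "\<forall>x\<in>T. \<exists>r>0. qball d x r \<subseteq> T"
      and x: "x \<in> S \<inter> T"
    obtain r where r: "r > 0" "qball d x r \<subseteq> S" using S x by blast
    obtain t where t: "t > 0" "qball d x t \<subseteq> T" using T x by blast
    have "qball d x (min r t) \<subseteq> S \<inter> T" using r t unfolding qball_def by auto
    moreover have "min r t > 0" using r t by simp
    ultimately show "\<exists>r>0. qball d x r \<subseteq> S \<inter> T" by blast
  next
    fix \<K> :: "'a set set" and x
    assume "\<forall>U\<in>\<K>. \<forall>x\<in>U. \<exists>r>0. qball d x r \<subseteq> U" "x \<in> \<Union> \<K>"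
    then show "\<exists>r>0. qball d x r \<subseteq> \<Union> \<K>" by (meson Sup_upper UnionE order_trans)
  qed
  then show ?thesis by (simp add: qtop_def)
qed

lemma topspace_qtop: "topspace (qtop d) = UNIV"
proof -
  have "openin (qtop d) UNIV" by (auto simp: openin_qtop intro: exI[of _ 1])
  then show ?thesis using openin_subset by blast
qed

text \<open>Distances to sets and diameters are taken in \<open>[0, \<infinity>]\<close>: the diameter of an unbounded
  set and the distance to the empty set are \<open>\<infinity>\<close>, the diameter of the empty set is \<open>0\<close>.\<close>

definition qdiam :: "('a \<Rightarrow> 'a \<Rightarrow> real) \<Rightarrow> 'a set \<Rightarrow> ennreal" where
  "qdiam d E = (SUP x\<in>E. SUP y\<in>E. ennreal (d x y))"

definition qdist :: "('a \<Rightarrow> 'a \<Rightarrow> real) \<Rightarrow> 'a \<Rightarrow> 'a set \<Rightarrow> ennreal" where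
  "qdist d x E = (INF y\<in>E. ennreal (d x y))"

text \<open>Real powers on \<open>[0, \<infinity>]\<close> with \<open>0\<^sup>a = \<infinity>\<close> for \<open>a < 0\<close> (whereas \<open>0 powr a = 0\<close> for
  reals), and \<open>x\<^sup>0 = 1\<close> throughout.\<close>

definition epow :: "ennreal \<Rightarrow> real \<Rightarrow> ennreal" where
  "epow x a =
     (if a = 0 then 1
      else if x = 0 then (if a < 0 then \<infinity> else 0)
      else if x = \<infinity> then (if a < 0 then 0 else \<infinity>)
      else ennreal (enn2real x powr a))"

definition borel_measure_finite_on_balls :: "('a \<Rightarrow> 'a \<Rightarrow> real) \<Rightarrow> 'a measure \<Rightarrow> bool" where
  "borel_measure_finite_on_balls d M \<longleftrightarrow>
     sets M = sets (sigma UNIV {U. openin (qtop d) U}) \<and>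
     (\<forall>x r. emeasure M (qball d x r) < \<infinity>)"

text \<open>The support condition is an almost-everywhere statement because \<open>Y\<close> need not be measurable,
  and \<open>emeasure\<close> vanishes on non-measurable sets.\<close>

definition ahlfors :: "('a \<Rightarrow> 'a \<Rightarrow> real) \<Rightarrow> 'a set \<Rightarrow> real \<Rightarrow> 'a measure \<Rightarrow> bool" where
  "ahlfors d Y \<alpha> M \<longleftrightarrow>
     borel_measure_finite_on_balls d M \<and> (AE x in M. x \<in> Y) \<and>
     (\<exists>c\<ge>1. \<forall>x\<in>Y. \<forall>r>0. ennreal r < qdiam d Y \<longrightarrow>
        ennreal (r powr \<alpha> / c) \<le> emeasure M (qball d x r) \<and>
        emeasure M (qball d x r) \<le> ennreal (c * r powr \<alpha>))"

definition locally_ahlfors :: "('a \<Rightarrow> 'a \<Rightarrow> real) \<Rightarrow> 'a set \<Rightarrow> real \<Rightarrow> 'a measure \<Rightarrow> bool" where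
  "locally_ahlfors d Y \<alpha> M \<longleftrightarrow>
     borel_measure_finite_on_balls d M \<and> (AE x in M. x \<in> Y) \<and>
     (\<exists>r0>0. \<exists>c\<ge>1. \<forall>x\<in>Y. \<forall>r>0. r < r0 \<longrightarrow>
        ennreal (r powr \<alpha> / c) \<le> emeasure M (qball d x r) \<and>
        emeasure M (qball d x r) \<le> ennreal (c * r powr \<alpha>))"

definition nonatomic_homogeneous :: "('a \<Rightarrow> 'a \<Rightarrow> real) \<Rightarrow> 'a measure \<Rightarrow> bool" where
  "nonatomic_homogeneous d M \<longleftrightarrow>
     (\<exists>A::real. \<forall>x. \<forall>r>0.
        0 < emeasure M (qball d x (2 * r)) \<and>
        emeasure M (qball d x (2 * r)) \<le> ennreal A * emeasure M (qball d x r) \<and>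
        ennreal A * emeasure M (qball d x r) < \<infinity>) \<and>
     (\<forall>x. emeasure M {x} = 0)"

definition maximal_fun ::
  "('a \<Rightarrow> 'a \<Rightarrow> real) \<Rightarrow> 'a measure \<Rightarrow> 'a measure \<Rightarrow> 'a \<Rightarrow> ennreal" where
  "maximal_fun d M N x = (SUP r\<in>{0<..}. emeasure N (qball d x r) / emeasure M (qball d x r))"

definition comparable_on :: "'b set \<Rightarrow> ('b \<Rightarrow> ennreal) \<Rightarrow> ('b \<Rightarrow> ennreal) \<Rightarrow> bool" where
  "comparable_on S f g \<longleftrightarrow>
     (\<exists>k1>0. \<exists>k2>0. \<forall>x\<in>S. ennreal k1 * g x \<le> f x \<and> f x \<le> ennreal k2 * g x)"

definition weight :: "('a \<Rightarrow> 'a \<Rightarrow> real) \<Rightarrow> 'a measure \<Rightarrow> ('a \<Rightarrow> ennreal) \<Rightarrow> bool" where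
  "weight d M w \<longleftrightarrow>
     w \<in> borel_measurable M \<and> (\<forall>x. \<forall>r>0. (\<integral>\<^sup>+y\<in>qball d x r. w y \<partial>M) < \<infinity>)"

definition ball_mean ::
  "('a \<Rightarrow> 'a \<Rightarrow> real) \<Rightarrow> 'a measure \<Rightarrow> ('a \<Rightarrow> ennreal) \<Rightarrow> 'a \<Rightarrow> real \<Rightarrow> ennreal" where
  "ball_mean d M w x r = (\<integral>\<^sup>+y\<in>qball d x r. w y \<partial>M) / emeasure M (qball d x r)"

definition muckenhoupt_A1 :: "('a \<Rightarrow> 'a \<Rightarrow> real) \<Rightarrow> 'a measure \<Rightarrow> ('a \<Rightarrow> ennreal) \<Rightarrow> bool" where
  "muckenhoupt_A1 d M w \<longleftrightarrow>
     weight d M w \<and>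
     (\<exists>C::real. \<forall>x. \<forall>r>0. AE y in M. y \<in> qball d x r \<longrightarrow> ball_mean d M w x r \<le> ennreal C * w y)"

text \<open>Both means in the \<open>A\<^sub>p\<close> product are required to be finite. Without the second finiteness
  condition the convention \<open>0 * \<infinity> = 0\<close> of \<open>ennreal\<close> would admit the zero function.\<close>

definition muckenhoupt_Ap ::
  "real \<Rightarrow> ('a \<Rightarrow> 'a \<Rightarrow> real) \<Rightarrow> 'a measure \<Rightarrow> ('a \<Rightarrow> ennreal) \<Rightarrow> bool" where
  "muckenhoupt_Ap p d M w \<longleftrightarrow>
     weight d M w \<and> weight d M (\<lambda>y. epow (w y) (- 1 / (p - 1))) \<and>
     (\<exists>C::real. \<forall>x. \<forall>r>0.
        ball_mean d M w x r * epow (ball_mean d M (\<lambda>y. epow (w y) (- 1 / (p - 1))) x r) (p - 1)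
          \<le> ennreal C)"

text \<open>The piecewise function equal to \<open>d(x, F\<^sub>i)\<close> raised to \<open>b\<^sub>i\<close> on each \<open>U\<^sub>i\<close> and to 1
  elsewhere. For pairwise disjoint \<open>U\<^sub>i\<close> at most one factor differs from 1.\<close>

definition piecewise_power ::
  "('a \<Rightarrow> 'a \<Rightarrow> real) \<Rightarrow> nat \<Rightarrow> (nat \<Rightarrow> 'a set) \<Rightarrow> (nat \<Rightarrow> 'a set) \<Rightarrow> (nat \<Rightarrow> real) \<Rightarrow> 'a \<Rightarrow> ennreal"
  where
  "piecewise_power d H F U b x =
     (\<Prod>i\<in>{1..H}. if x \<in> U i then epow (qdist d x (F i)) (b i) else 1)"

end

theory Submission
  imports Defs
begin

text \<open>Write \<open>\<rho>\<^sub>i(x) = d(x, F\<^sub>i)\<close> and take \<open>U\<^sub>i = {\<rho>\<^sub>i < \<delta>}\<close> with one small \<open>\<delta> \<le> 1\<close>. If \<open>2K\<delta>\<close> is at most every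
distance between two different pieces, the \<open>U\<^sub>i\<close> are disjoint, and from then on the pieces can be
treated one at a time: near \<open>F\<^sub>i\<close> the other distances stay above \<open>\<delta>\<close> and contribute only constants.

The maximal function is computed by comparing radii with \<open>\<rho>\<^sub>i(x)\<close>. A ball \<open>B(x, r)\<close> has \<open>\<nu>\<^sub>i\<close>-mass
only if \<open>r > \<rho>\<^sub>i(x)\<close>; for such small \<open>r\<close> the ratio of masses is at most of order \<open>r\<^sup>s\<^sup>-\<^sup>\<alpha>\<close>, which
decreases in \<open>r\<close>, and for large \<open>r\<close> it is bounded, so \<open>M\<nu>\<^sub>i \<lesssim> 1 + \<rho>\<^sub>i\<^sup>s\<^sup>-\<^sup>\<alpha>\<close> everywhere
(\<open>\<nu>_ball_le\<close>). The radius \<open>3K\<rho>\<^sub>i(x)\<close> gives the reverse inequality near \<open>F\<^sub>i\<close>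
(\<open>maximal_fun_lower\<close>). Away from \<open>F\<close> the best ball is the smallest one that contains all of \<open>F\<close>.

For the weights the classical route is that powers \<open>(M\<nu>)\<^sup>\<gamma>\<close> with \<open>\<gamma> < 1\<close> are \<open>A\<^sub>1\<close>, by a weak-type
inequality. Here the distance powers are integrated directly instead. A maximal separated net in
\<open>F\<^sub>i\<close>, whose cardinality is controlled by \<open>\<nu>\<^sub>i\<close>, shows that the \<open>t\<close>-neighbourhood of \<open>F\<^sub>i\<close> inside a
ball of radius \<open>r\<close> near \<open>F\<^sub>i\<close> has measure at most of order \<open>r\<^sup>s t\<^sup>\<alpha>\<^sup>-\<^sup>s\<close> (\<open>neighbourhood_measure\<close>,
\<open>level_set_measure\<close>); summing over dyadic \<open>t\<close> (\<open>nn_integral_power_dyadic\<close>) bounds the mean of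
\<open>\<rho>\<^sub>i\<^sup>b\<close> by \<open>r\<^sup>b\<close> as long as \<open>- (\<alpha> - s) < b < 0\<close>. This yields an \<open>A\<^sub>1\<close> estimate in a strong form, with
an explicit lower bound of the weight on each ball (\<open>A1_minorant\<close>). That form is stable under
taking maxima of finitely many weights, which passes from the single pieces to the piecewise
weight (\<open>A1_minorant_dominated\<close>), and it makes the easy half of Jones factorization immediate:
\<open>w\<^sub>1 w\<^sub>2\<^sup>1\<^sup>-\<^sup>p\<close> is \<open>A\<^sub>p\<close> (\<open>A1_minorants_imp_Ap\<close>). A weight with exponents \<open>\<beta>\<^sub>i\<close> of both signs is such a
product: the negative \<open>\<beta>\<^sub>i\<close> go into \<open>w\<^sub>1\<close> and the positive ones, divided by \<open>1 - p\<close>, into \<open>w\<^sub>2\<close>.\<close>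

section \<open>Powers and dyadic integrals on the extended half-line\<close>

lemma epow_0_right [simp]: "epow x 0 = 1"
  by (simp add: epow_def)

lemma epow_ennreal: "0 < x \<Longrightarrow> epow (ennreal x) a = ennreal (x powr a)"
  by (auto simp: epow_def ennreal_eq_0_iff)

lemma epow_1_left [simp]: "epow 1 a = 1"
  using epow_ennreal[of 1 a] by simp

lemma epow_top_neg: "a < 0 \<Longrightarrow> epow top a = 0"
  by (simp add: epow_def)

lemma epow_0_neg: "a < 0 \<Longrightarrow> epow 0 a = top"
  by (simp add: epow_def)

lemma ennreal_trichotomy:
  fixes x :: ennreal
  obtains "x = 0" | u where "0 < u" "x = ennreal u" | "x = top"
proof (cases x)
  case (real u)
  then show ?thesis using that by (cases "u = 0") auto
qed (use that in auto)

lemma ennreal_eq_topI: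
  assumes "\<And>r. ennreal r \<le> x" shows "x = top"
proof (cases x)
  case (real u)
  then have "u + 1 \<le> u" using assms[of "u + 1"] by (simp add: ennreal_le_iff)
  then show ?thesis by simp
qed

lemma ennreal_between:
  assumes "(0::ennreal) < a"
  shows "\<exists>t>0. ennreal t < a"
proof -
  obtain x where x: "0 < x" "x < a" using dense[OF assms] by blast
  then obtain t where "x = ennreal t" "0 \<le> t" using less_top_ennreal[of x] less_le_trans[of x a top] by auto
  then show ?thesis using x by (intro exI[of _ t]) auto
qed

lemma ennreal_mult3: "0 \<le> a \<Longrightarrow> 0 \<le> b \<Longrightarrow> 0 \<le> c \<Longrightarrow> ennreal (a * b * c) = ennreal a * ennreal b * ennreal c"
  by (simp add: ennreal_mult)

text \<open>The conventions \<open>0\<^sup>a = \<infinity>\<close> for \<open>a < 0\<close> and \<open>x\<^sup>0 = 1\<close> are exactly those for which iterated powers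
multiply their exponents at \<open>0\<close> and \<open>\<infinity>\<close> too.\<close>

lemma epow_epow: "epow (epow x a) b = epow x (a * b)"
proof -
  consider "a = 0 \<or> b = 0" | "a \<noteq> 0" "b \<noteq> 0" by blast
  then show ?thesis
  proof cases
    case 2
    show ?thesis
    proof (cases x rule: ennreal_trichotomy)
      case (2 u)
      then show ?thesis by (simp add: epow_ennreal powr_powr)
    qed (use 2 in \<open>auto simp: epow_def zero_less_mult_iff mult_less_0_iff\<close>)
  qed auto
qed

lemma epow_antimono: 
  assumes "a \<le> 0" "x \<le> y" shows "epow y a \<le> epow x a"
proof (cases "a = 0")
  case False
  then have a: "a < 0" using assms by simp
  show ?thesis
  proof (cases x rule: ennreal_trichotomy)
    case (2 u)
    then show ?thesis
    proof (cases y rule: ennreal_trichotomy)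
      case (2 v)
      then show ?thesis using assms \<open>0 < u\<close> \<open>x = ennreal u\<close>
        by (simp add: epow_ennreal powr_mono2')
    qed (use a assms \<open>0 < u\<close> in \<open>auto simp: epow_def\<close>)
  qed (use a assms in \<open>auto simp: epow_def top_unique\<close>)
qed simp

lemma epow_mono: 
  assumes "0 \<le> a" "x \<le> y" shows "epow x a \<le> epow y a"
proof (cases "a = 0")
  case False
  then have a: "a > 0" using assms by simp
  show ?thesis
  proof (cases x rule: ennreal_trichotomy)
    case (2 u)
    then show ?thesis
    proof (cases y rule: ennreal_trichotomy)
      case (2 v)
      then show ?thesis using a assms \<open>0 < u\<close> \<open>x = ennreal u\<close>
        by (simp add: epow_ennreal powr_mono2)
    qed (use a assms \<open>0 < u\<close> in \<open>auto simp: epow_def\<close>)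
  qed (use a assms in \<open>auto simp: epow_def top_unique\<close>)
qed simp

lemma measurable_epow [measurable (raw)]:
  assumes [measurable]: "f \<in> borel_measurable M"
  shows "(\<lambda>x. epow (f x) a) \<in> borel_measurable M"
proof -
  have [measurable]: "(\<lambda>x. enn2real (f x) powr a) \<in> borel_measurable M"
    by (intro powr_real_measurable) auto
  have [measurable]: "{x \<in> space M. f x = 0} \<in> sets M" "{x \<in> space M. f x = top} \<in> sets M"
    by simp_all
  show ?thesis
    unfolding epow_def infinity_ennreal_def by (intro measurable_If) auto
qed

lemma ennreal_term_le_suminf: "f k \<le> (\<Sum>k. f k)" for f :: "nat \<Rightarrow> ennreal"
  using sum_le_suminf[of f "{k}"] by simp

lemma two_power_powr: "((2::real) ^ n) powr a = (2 powr a) ^ n"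
proof -
  have "((2::real) ^ n) powr a = (2 powr real n) powr a" by (subst powr_realpow) auto
  then show ?thesis by (simp add: powr_powr powr_power)
qed

text \<open>On the shell \<open>t\<^sub>1 / 2\<^sup>k\<^sup>+\<^sup>1 \<le> f < t\<^sub>1 / 2\<^sup>k\<close> the power \<open>f\<^sup>b\<close> is at most \<open>(t\<^sub>1 / 2\<^sup>k\<^sup>+\<^sup>1)\<^sup>b\<close>, and the shell is
part of a sublevel set of measure at most \<open>q (t\<^sub>1 / 2\<^sup>k)\<^sup>\<kappa>\<close>; the products form a geometric series
with ratio \<open>2\<^sup>-\<^sup>(\<^sup>\<kappa>\<^sup>+\<^sup>b\<^sup>)\<close>.\<close>

lemma nn_integral_power_dyadic:
  assumes [measurable]: "f \<in> borel_measurable M" "B \<in> sets M"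
    and q: "0 \<le> q" and t1: "0 < t1" and b: "b < 0" "0 < \<kappa> + b"
    and level: "\<And>t. 0 < t \<Longrightarrow> t \<le> t1 \<Longrightarrow>
      emeasure M {y \<in> B. f y < ennreal t} \<le> ennreal (q * t powr \<kappa>)"
  shows "(\<integral>\<^sup>+y\<in>{y \<in> B. f y < ennreal t1}. epow (f y) b \<partial>M)
    \<le> ennreal (2 powr (- b) / (1 - 2 powr (- (\<kappa> + b))) * q * t1 powr (\<kappa> + b))"
proof -
  have B: "B \<subseteq> space M" using assms(2) by (rule sets.sets_into_space)
  define L where "L k = {y \<in> B. f y < ennreal (t1 / 2 ^ k)}" for k :: nat
  have L_meas [measurable]: "L k \<in> sets M" for k
  proof -
    have "L k = B \<inter> {y \<in> space M. f y < ennreal (t1 / 2 ^ k)}" using B by (auto simp: L_def)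
    then show ?thesis by simp
  qed
  define h where "h k = (t1 / 2 ^ Suc k) powr b" for k :: nat
  have h_eq: "h k = t1 powr b * (2 powr (- b)) ^ Suc k" for k
  proof -
    have "h k = t1 powr b / (2 ^ Suc k) powr b" unfolding h_def by (rule powr_divide)
    also have "(2 ^ Suc k) powr b = (2 powr b) ^ Suc k"
      by (rule two_power_powr)
    also have "t1 powr b / (2 powr b) ^ Suc k = t1 powr b * inverse ((2 powr b) ^ Suc k)"
      by (rule divide_inverse)
    finally show ?thesis by (simp only: powr_minus power_inverse)
  qed
  (* Using the whole sublevel sets rather than the shells makes the series diverge where f vanishes,
     so the bound holds at every point and no null set has to be removed. *)
  have ptw: "epow (f y) b * indicator {y \<in> B. f y < ennreal t1} y
      \<le> (\<Sum>k. ennreal (h k) * indicator (L k) y)" for y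
  proof (cases "y \<in> B \<and> f y < ennreal t1")
    case True
    have term_le: "ennreal (h k) * indicator (L k) y \<le> (\<Sum>k. ennreal (h k) * indicator (L k) y)" for k
      by (rule ennreal_term_le_suminf)
    show ?thesis
    proof (cases "f y" rule: ennreal_trichotomy)
      case 1
      have "ennreal x \<le> (\<Sum>k. ennreal (h k) * indicator (L k) y)" for x
      proof -
        have "1 < 2 powr (- b)" using b by (intro gr_one_powr) auto
        then obtain k where "x / t1 powr b < (2 powr (- b)) ^ k" using real_arch_pow by blast
        also have "\<dots> \<le> (2 powr (- b)) ^ Suc k" 
          using \<open>1 < 2 powr (- b)\<close> by (intro power_increasing) linarith+
        finally have "x \<le> h k" using t1 by (simp add: h_eq field_simps)
        then have "ennreal x \<le> ennreal (h k) * indicator (L k) y"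
          using 1 True t1 by (simp add: L_def ennreal_leI)
        then show ?thesis using term_le order_trans by blast
      qed
      then have "(\<Sum>k. ennreal (h k) * indicator (L k) y) = top"
        by (rule ennreal_eq_topI)
      then show ?thesis by simp
    next
      case (2 u)
      then have u: "0 < u" "u < t1" using True by (auto simp: ennreal_less_iff)
      obtain n where n: "t1 / u < 2 ^ n" using real_arch_pow[of 2 "t1 / u"] by auto
      have ex: "\<exists>n. t1 / 2 ^ n \<le> u" using n u by (intro exI[of _ n]) (auto simp: field_simps)
      define j where "j = (LEAST n. t1 / 2 ^ n \<le> u)"
      have j: "t1 / 2 ^ j \<le> u" unfolding j_def by (rule LeastI_ex[OF ex])
      then obtain k where k: "j = Suc k" using u by (cases j) auto
      have k2: "u < t1 / 2 ^ k" using not_less_Least[of k "\<lambda>n. t1 / 2 ^ n \<le> u"] k by (auto simp: j_def)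
      have "u powr b \<le> h k" unfolding h_def using j k u b t1 by (intro powr_mono2') auto
      then have "epow (f y) b \<le> ennreal (h k) * indicator (L k) y"
        using 2 k2 True u by (auto simp: L_def epow_ennreal ennreal_leI ennreal_less_iff)
      then show ?thesis using term_le[of k] True by (auto intro: order_trans)
    qed (use True in auto)
  qed auto
  have h_nonneg: "0 \<le> h k" for k by (simp add: h_def)
  define z where "z = 2 powr (- (\<kappa> + b))"
  have z: "0 < z" "z < 1" using b by (auto simp: z_def powr_less_one)
  have term_eq: "h k * (q * (t1 / 2 ^ k) powr \<kappa>) = 2 powr (- b) * q * t1 powr (\<kappa> + b) * z ^ k" for k
  proof -
    have "(t1 / 2 ^ k) powr \<kappa> = t1 powr \<kappa> / (2 ^ k) powr \<kappa>" by (rule powr_divide)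
    also have "(2 ^ k) powr \<kappa> = (2 powr \<kappa>) ^ k"
      by (rule two_power_powr)
    finally have "(t1 / 2 ^ k) powr \<kappa> = t1 powr \<kappa> / (2 powr \<kappa>) ^ k" .
    moreover have "z ^ k = (2 powr (- b)) ^ k / (2 powr \<kappa>) ^ k"
    proof -
      have "z = 2 powr (- b) / 2 powr \<kappa>"
        unfolding z_def by (subst powr_diff[symmetric]) (rule arg_cong[where f = "(powr) 2"], simp)
      then show ?thesis by (simp add: power_divide)
    qed
    ultimately show ?thesis by (simp add: h_eq powr_add)
  qed
  have "(\<integral>\<^sup>+y\<in>{y \<in> B. f y < ennreal t1}. epow (f y) b \<partial>M)
      \<le> (\<integral>\<^sup>+y. (\<Sum>k. ennreal (h k) * indicator (L k) y) \<partial>M)"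
    by (intro nn_integral_mono ptw)
  also have "\<dots> = (\<Sum>k. ennreal (h k) * emeasure M (L k))"
    by (subst nn_integral_suminf) (auto simp: nn_integral_cmult_indicator)
  also have "\<dots> \<le> (\<Sum>k. ennreal (h k) * ennreal (q * (t1 / 2 ^ k) powr \<kappa>))"
  proof (intro suminf_le mult_left_mono)
    fix k show "emeasure M (L k) \<le> ennreal (q * (t1 / 2 ^ k) powr \<kappa>)"
      unfolding L_def by (rule level) (use t1 in \<open>auto simp: field_simps\<close>)
  qed auto
  also have "\<dots> = (\<Sum>k. ennreal (2 powr (- b) * q * t1 powr (\<kappa> + b) * z ^ k))"
  proof -
    have "ennreal (h k) * ennreal (q * (t1 / 2 ^ k) powr \<kappa>)
        = ennreal (2 powr (- b) * q * t1 powr (\<kappa> + b) * z ^ k)" for k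
      unfolding term_eq[symmetric] by (rule ennreal_mult[symmetric]) (use q h_nonneg in auto)
    then show ?thesis by simp
  qed
  also have "\<dots> = ennreal (2 powr (- b) * q * t1 powr (\<kappa> + b) * (1 / (1 - z)))"
    by (intro suminf_ennreal_eq sums_mult geometric_sums) (use q z in auto)
  finally show ?thesis by (simp add: z_def mult_ac)
qed

section \<open>Ahlfors regular quasi-metric spaces\<close>

text \<open>The upper mass bound holds for all radii and the lower one up to and including the diameter. The
Ahlfors condition gives both only below the diameter; doubling and an enlarged constant remove
the restrictions (\<open>ahlfors_regularI\<close>).\<close>

locale ahlfors_regular =
  fixes d :: "'a \<Rightarrow> 'a \<Rightarrow> real" and K \<alpha> :: real and \<mu> :: "'a measure" and c :: real
  assumes quasi_metric: "quasi_metric K d"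
    and openin_ball: "openin (qtop d) (qball d x r)"
    and sets_\<mu>: "sets \<mu> = sets (sigma UNIV {U. openin (qtop d) U})"
    and \<alpha>_pos: "0 < \<alpha>"
    and c_ge_1: "1 \<le> c"
    and nontrivial: "0 < qdiam d UNIV"
    and \<mu>_ball_upper: "0 < r \<Longrightarrow> emeasure \<mu> (qball d x r) \<le> ennreal (c * r powr \<alpha>)"
    and \<mu>_ball_lower: "0 < r \<Longrightarrow> ennreal r \<le> qdiam d UNIV \<Longrightarrow>
      ennreal (r powr \<alpha> / c) \<le> emeasure \<mu> (qball d x r)"
begin

lemma d_nonneg [simp]: "0 \<le> d x y"
  and d_commute: "d x y = d y x"
  and d_eq_0_iff [simp]: "d x y = 0 \<longleftrightarrow> x = y"
  and K_ge_1: "1 \<le> K"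
  and d_triangle: "d x y \<le> K * (d x z + d z y)"
  using quasi_metric by (auto simp: quasi_metric_def)

lemma d_self [simp]: "d x x = 0"
  by simp

lemma K_pos [simp]: "0 < K" "0 \<le> K" "K \<noteq> 0"
  using K_ge_1 by auto

lemma c_pos [simp]: "0 < c" "0 \<le> c" "c \<noteq> 0"
  using c_ge_1 by auto

lemma K_mult_ge: "0 \<le> x \<Longrightarrow> x \<le> K * x"
  using K_ge_1 by (simp add: mult_le_cancel_right1)

lemma d_triangle_less: "d x z < a \<Longrightarrow> d z y < b \<Longrightarrow> d x y < K * (a + b)"
  by (rule le_less_trans[OF d_triangle[of x y z]]) (auto intro: mult_strict_left_mono)

lemma qball_subset: "d x y < a \<Longrightarrow> K * (a + r) \<le> R \<Longrightarrow> qball d y r \<subseteq> qball d x R"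
  unfolding qball_def using d_triangle_less by fastforce

lemma qball_mono: "r \<le> R \<Longrightarrow> qball d x r \<subseteq> qball d x R"
  by (auto simp: qball_def)

lemma sets_open: "openin (qtop d) U \<Longrightarrow> U \<in> sets \<mu>"
  by (simp add: sets_\<mu>)

lemma sets_ball [measurable]: "qball d x r \<in> sets \<mu>"
  by (rule sets_open[OF openin_ball])

lemma space_\<mu> [simp]: "space \<mu> = UNIV"
  using sets_eq_imp_space_eq[OF sets_\<mu>] by (simp add: space_measure_of_conv)

text \<open>A fixed radius below which the lower mass bound always applies; a real number is needed because
the diameter may be infinite.\<close>

definition D :: real where "D = (SOME t. 0 < t \<and> ennreal t \<le> qdiam d UNIV)"

lemma D_pos [simp]: "0 < D" and D_le: "ennreal D \<le> qdiam d UNIV"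
proof -
  obtain t where "0 < t" "ennreal t < qdiam d UNIV"
    using ennreal_between[OF nontrivial] by blast
  then have "\<exists>t. 0 < t \<and> ennreal t \<le> qdiam d UNIV" using less_imp_le by blast
  from someI_ex[OF this] show "0 < D" "ennreal D \<le> qdiam d UNIV" by (auto simp: D_def)
qed

lemma \<mu>_ball_lower': "0 < r \<Longrightarrow> r \<le> D \<Longrightarrow> ennreal (r powr \<alpha> / c) \<le> emeasure \<mu> (qball d x r)"
  by (rule \<mu>_ball_lower) (assumption, erule order_trans[OF ennreal_leI D_le])

lemma \<mu>_ball_ge:
  assumes "0 < t"
  shows "\<exists>k>0. \<forall>x r. t \<le> r \<longrightarrow> ennreal k \<le> emeasure \<mu> (qball d x r)"
proof (intro exI[of _ "min t D powr \<alpha> / c"] conjI allI impI)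
  show "0 < min t D powr \<alpha> / c" using assms D_pos by (auto simp: min_def less_imp_neq[symmetric])
  fix x r assume "t \<le> r"
  have "ennreal (min t D powr \<alpha> / c) \<le> emeasure \<mu> (qball d x (min t D))"
    by (rule \<mu>_ball_lower') (use assms in auto)
  also have "\<dots> \<le> emeasure \<mu> (qball d x r)"
    by (intro emeasure_mono qball_mono) (use \<open>t \<le> r\<close> in auto)
  finally show "ennreal (min t D powr \<alpha> / c) \<le> emeasure \<mu> (qball d x r)" .
qed

lemma \<mu>_ball_pos: "0 < r \<Longrightarrow> 0 < emeasure \<mu> (qball d x r)"
proof -
  assume "0 < r"
  then obtain k where "0 < k" "ennreal k \<le> emeasure \<mu> (qball d x r)" using \<mu>_ball_ge[of r] by blast
  then show ?thesis by (meson ennreal_less_zero_iff order_less_le_trans)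
qed

lemma \<mu>_ball_finite: "emeasure \<mu> (qball d x r) < top"
proof -
  have "emeasure \<mu> (qball d x r) \<le> emeasure \<mu> (qball d x (max r 1))"
    by (intro emeasure_mono qball_mono) auto
  also have "\<dots> \<le> ennreal (c * max r 1 powr \<alpha>)" by (rule \<mu>_ball_upper) auto
  finally show ?thesis using ennreal_less_top order_le_less_trans by blast
qed

subsection \<open>The distance to a set\<close>

lemma qdist_less_iff: "qdist d x E < t \<longleftrightarrow> (\<exists>y\<in>E. ennreal (d x y) < t)"
  by (simp add: qdist_def INF_less_iff)

lemma qdist_less_ennreal_iff: "qdist d x E < ennreal t \<longleftrightarrow> (\<exists>y\<in>E. d x y < t)"
  by (simp add: qdist_less_iff ennreal_less_iff)

lemma qdist_le: "y \<in> E \<Longrightarrow> qdist d x E \<le> ennreal (d x y)"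
  unfolding qdist_def by (rule INF_lower)

lemma qdist_empty [simp]: "qdist d x {} = top"
  by (simp add: qdist_def)

lemma qdist_finite: "E \<noteq> {} \<Longrightarrow> qdist d x E < top"
  by (auto simp: qdist_less_iff)

lemma qdist_triangle: "qdist d x E \<le> ennreal K * (ennreal (d x y) + qdist d y E)"
proof (cases "E = {}")
  case False
  then obtain e where e: "qdist d y E = ennreal e" "0 \<le> e"
    using qdist_finite[of E y] by (cases "qdist d y E") auto
  show ?thesis
  proof (rule ennreal_le_epsilon)
    fix \<epsilon> :: real assume \<epsilon>: "0 < \<epsilon>"
    have "qdist d y E < ennreal (e + \<epsilon> / K)" using e \<epsilon> by (simp add: ennreal_less_iff)
    then obtain z where z: "z \<in> E" "d y z < e + \<epsilon> / K" by (auto simp: qdist_less_ennreal_iff)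
    have "qdist d x E \<le> ennreal (d x z)" by (rule qdist_le[OF z(1)])
    also have "d x z \<le> K * (d x y + (e + \<epsilon> / K))"
      by (rule order_trans[OF d_triangle[of x z y]]) (use z in \<open>auto intro: mult_left_mono\<close>)
    also have "\<dots> = K * (d x y + e) + \<epsilon>" by (simp add: field_simps)
    finally show "qdist d x E \<le> ennreal K * (ennreal (d x y) + qdist d y E) + ennreal \<epsilon>"
      using e \<epsilon> by (simp add: ennreal_leI ennreal_mult[symmetric] ennreal_plus[symmetric] del: ennreal_plus)
  qed
qed (simp add: ennreal_mult_top)

lemma openin_qdist_less: "openin (qtop d) {x. qdist d x E < t}"
proof -
  have "openin (qtop d) {x. ennreal (d x y) < t}" for y
  proof (cases t)
    case (real u)
    then have "{x. ennreal (d x y) < t} = qball d y u"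
      by (auto simp: qball_def ennreal_less_iff d_commute)
    then show ?thesis by (simp add: openin_ball)
  next
    case top
    then have "{x. ennreal (d x y) < t} = topspace (qtop d)" by (simp add: topspace_qtop)
    then show ?thesis by (metis openin_topspace)
  qed
  then have "openin (qtop d) (\<Union>y\<in>E. {x. ennreal (d x y) < t})" by blast
  moreover have "(\<Union>y\<in>E. {x. ennreal (d x y) < t}) = {x. qdist d x E < t}"
    by (auto simp: qdist_less_iff)
  ultimately show ?thesis by simp
qed

lemma measurable_qdist [measurable]: "(\<lambda>x. qdist d x E) \<in> borel_measurable \<mu>"
  by (rule borel_measurableI_less) (simp add: sets_open[OF openin_qdist_less])

lemma qdist_pos:
  assumes "closedin (qtop d) E" "x \<notin> E"
  shows "0 < qdist d x E"
proof -
  have "openin (qtop d) (- E)" 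
    using assms(1) by (simp add: closedin_def topspace_qtop Compl_eq_Diff_UNIV)
  then obtain r where r: "0 < r" "qball d x r \<subseteq> - E" using assms(2) by (auto simp: openin_qtop)
  then have "\<not> qdist d x E < ennreal r" by (auto simp: qdist_less_ennreal_iff qball_def)
  then show ?thesis using r by (meson ennreal_less_zero_iff not_less order_less_le_trans)
qed

subsection \<open>The maximal function\<close>

lemma maximal_fun_le:
  assumes "\<And>r. 0 < r \<Longrightarrow> emeasure N (qball d x r) \<le> k * emeasure \<mu> (qball d x r)"
  shows "maximal_fun d \<mu> N x \<le> k"
  unfolding maximal_fun_def
proof (rule SUP_least)
  fix r :: real assume "r \<in> {0<..}"
  then show "emeasure N (qball d x r) / emeasure \<mu> (qball d x r) \<le> k"
    using assms \<mu>_ball_pos by (intro divide_le_posI_ennreal) (auto simp: mult.commute)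
qed

lemma maximal_fun_ge:
  assumes "0 < r" "0 \<le> a" "ennreal a \<le> emeasure N (qball d x r)"
  shows "ennreal (a / (c * r powr \<alpha>)) \<le> maximal_fun d \<mu> N x"
proof -
  have "ennreal (a / (c * r powr \<alpha>)) = ennreal a / ennreal (c * r powr \<alpha>)"
    using assms by (simp add: divide_ennreal)
  also have "\<dots> \<le> emeasure N (qball d x r) / emeasure \<mu> (qball d x r)" (is "_ \<le> ?q")
  proof (rule divide_le_posI_ennreal)
    have "ennreal a \<le> emeasure \<mu> (qball d x r) * ?q"
      using assms(3) \<mu>_ball_pos[OF assms(1), of x] \<mu>_ball_finite[of x r]
      by (simp add: ennreal_times_divide mult.commute[of "emeasure \<mu> _"] mult_divide_eq_ennreal)
    also have "\<dots> \<le> ennreal (c * r powr \<alpha>) * ?q"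
      by (intro mult_right_mono \<mu>_ball_upper assms) auto
    finally show "ennreal a \<le> ennreal (c * r powr \<alpha>) * ?q" .
  qed (use assms in simp)
  also have "\<dots> \<le> maximal_fun d \<mu> N x"
    unfolding maximal_fun_def using assms by (intro SUP_upper) auto
  finally show ?thesis .
qed

lemma maximal_fun_mono:
  assumes "\<And>x r. emeasure N (qball d x r) \<le> emeasure N' (qball d x r)"
  shows "maximal_fun d \<mu> N x \<le> maximal_fun d \<mu> N' x"
  unfolding maximal_fun_def by (intro SUP_mono) (auto intro!: bexI divide_right_mono_ennreal assms)

end

text \<open>If \<open>\<alpha> \<le> 0\<close>, the masses of the balls shrinking to a point would not tend to zero, although points
have measure zero; so \<open>\<alpha>\<close> is positive. Beyond the diameter \<open>R\<close> a ball is the whole space, and two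
doubling steps bound its mass by that of a ball of radius \<open>R / 2\<close>.\<close>

lemma ahlfors_regularI:
  assumes "quasi_metric K d" "\<And>x r. openin (qtop d) (qball d x r)"
    and "ahlfors d UNIV \<alpha> \<mu>" and hom: "nonatomic_homogeneous d \<mu>"
  shows "\<exists>c. ahlfors_regular d K \<alpha> \<mu> c"
proof -
  have d: "\<And>x y. 0 \<le> d x y" "\<And>x y. d x y = 0 \<longleftrightarrow> x = y" "\<And>x y. d x y = d y x"
    using assms(1) by (auto simp: quasi_metric_def)
  obtain c0 where c0: "1 \<le> c0"
    and bounds: "\<And>x r. 0 < r \<Longrightarrow> ennreal r < qdiam d UNIV \<Longrightarrow>
      ennreal (r powr \<alpha> / c0) \<le> emeasure \<mu> (qball d x r) \<and>
      emeasure \<mu> (qball d x r) \<le> ennreal (c0 * r powr \<alpha>)"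
    using assms(3) unfolding ahlfors_def by blast
  have sets_\<mu>: "sets \<mu> = sets (sigma UNIV {U. openin (qtop d) U})"
    and finite_ball: "\<And>x r. emeasure \<mu> (qball d x r) < top"
    using assms(3) by (auto simp: ahlfors_def borel_measure_finite_on_balls_def)
  have meas [simp]: "qball d x r \<in> sets \<mu>" for x r
    using assms(2) by (simp add: sets_\<mu>)
  obtain A :: real where A: "\<And>x r. 0 < r \<Longrightarrow> 0 < emeasure \<mu> (qball d x (2 * r)) \<and>
      emeasure \<mu> (qball d x (2 * r)) \<le> ennreal A * emeasure \<mu> (qball d x r)"
    and atom: "\<And>x. emeasure \<mu> {x} = 0"
    using hom unfolding nonatomic_homogeneous_def by blast
  have qdiam_ge: "ennreal (d x y) \<le> qdiam d UNIV" for x y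
    unfolding qdiam_def by (rule order_trans[OF _ SUP_upper[of x]], rule SUP_upper) auto
  have nontrivial: "0 < qdiam d UNIV"
  proof (rule ccontr)
    fix x :: 'a
    assume "\<not> 0 < qdiam d UNIV"
    then have "d x y = 0" for x y
      using qdiam_ge[of x y] d(1)[of x y] by (simp add: antisym)
    then have "qball d x 2 = {x}" using d(2) by (auto simp: qball_def)
    then show False using A[of 1 x] atom[of x] by simp
  qed
  obtain D where D: "0 < D" "ennreal D < qdiam d UNIV"
    using ennreal_between[OF nontrivial] by blast
  have \<alpha>: "0 < \<alpha>"
  proof (rule ccontr)
    fix x :: 'a
    assume neg: "\<not> 0 < \<alpha>"
    define B where "B n = qball d x (D / real (Suc n))" for n
    have "decseq B"
    proof (rule decseq_SucI)
      fix n
      have "D / real (Suc (Suc n)) \<le> D / real (Suc n)" using D(1) by (intro divide_left_mono) auto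
      then show "B (Suc n) \<subseteq> B n" unfolding B_def qball_def by auto
    qed
    moreover have "range B \<subseteq> sets \<mu>" by (auto simp: B_def)
    moreover have "emeasure \<mu> (B n) \<noteq> \<infinity>" for n using finite_ball[of x "D / real (Suc n)"] by (simp add: B_def)
    ultimately have "(INF n. emeasure \<mu> (B n)) = emeasure \<mu> (\<Inter>n. B n)"
      by (intro INF_emeasure_decseq) auto
    also have "(\<Inter>n. B n) = {x}"
    proof -
      have "y = x" if y: "\<And>n. y \<in> B n" for y
      proof (rule ccontr)
        assume "y \<noteq> x"
        then have "0 < d x y" using d(1)[of x y] d(2)[of x y] by auto
        then obtain n where "D / d x y < real n" using reals_Archimedean2 by blast
        then have "D / real (Suc n) < d x y" using \<open>0 < d x y\<close> by (simp add: field_simps)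
        then show False using y[of n] by (simp add: B_def qball_def)
      qed
      moreover have "x \<in> B n" for n using D(1) d(2)[of x x] by (simp add: B_def qball_def)
      ultimately show ?thesis by auto
    qed
    finally have "(INF n. emeasure \<mu> (B n)) = 0" using atom by simp
    moreover have "ennreal (D powr \<alpha> / c0) \<le> (INF n. emeasure \<mu> (B n))"
    proof (rule INF_greatest)
      fix n
      have le: "D / real (Suc n) \<le> D" using D(1) by (simp add: divide_le_eq)
      have "D powr \<alpha> \<le> (D / real (Suc n)) powr \<alpha>"
        using neg D(1) le by (intro powr_mono2') auto
      then have "ennreal (D powr \<alpha> / c0) \<le> ennreal ((D / real (Suc n)) powr \<alpha> / c0)"
        using c0 by (intro ennreal_leI divide_right_mono) auto
      also have "\<dots> \<le> emeasure \<mu> (B n)"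
        unfolding B_def
        using bounds[of "D / real (Suc n)" x] D order_le_less_trans[OF ennreal_leI[OF le] D(2)] by simp
      finally show "ennreal (D powr \<alpha> / c0) \<le> emeasure \<mu> (B n)" .
    qed
    ultimately show False using D(1) c0 by (simp add: not_le)
  qed
  define c where "c = c0 * 2 powr \<alpha> * max 1 (A * A)"
  have c_ge: "c0 * 2 powr \<alpha> \<le> c"
    unfolding c_def using mult_left_mono[of 1 "max 1 (A * A)" "c0 * 2 powr \<alpha>"] c0 by simp
  have two: "1 \<le> 2 powr \<alpha>" using \<alpha> by (simp add: ge_one_powr_ge_zero)
  then have c_ge0: "c0 \<le> c" using c0 c_ge mult_left_mono[of 1 "2 powr \<alpha>" c0] by linarith
  show ?thesis
  proof (intro exI[of _ c], unfold_locales)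
    show "1 \<le> c" using c0 c_ge0 by simp
  next
    fix r x assume r: "0 < r" "ennreal r \<le> qdiam d UNIV"
    have "r powr \<alpha> / c \<le> r powr \<alpha> / (c0 * 2 powr \<alpha>)"
      using c_ge c_ge0 c0 by (intro divide_left_mono mult_pos_pos) auto
    also have "\<dots> = (r / 2) powr \<alpha> / c0" by (simp add: powr_divide)
    finally have "ennreal (r powr \<alpha> / c) \<le> ennreal ((r / 2) powr \<alpha> / c0)" by (rule ennreal_leI)
    also have "ennreal (r / 2) < ennreal r" using r by (intro ennreal_lessI) auto
    then have "ennreal ((r / 2) powr \<alpha> / c0) \<le> emeasure \<mu> (qball d x (r / 2))"
      using bounds[of "r / 2" x] r by auto
    also have "\<dots> \<le> emeasure \<mu> (qball d x r)"
      by (rule emeasure_mono) (use r in \<open>auto simp: qball_def intro: meas[unfolded qball_def]\<close>)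
    finally show "ennreal (r powr \<alpha> / c) \<le> emeasure \<mu> (qball d x r)" .
  next
    fix r x assume r: "0 < (r::real)"
    show "emeasure \<mu> (qball d x r) \<le> ennreal (c * r powr \<alpha>)"
    proof (cases "ennreal r < qdiam d UNIV")
      case True
      have "emeasure \<mu> (qball d x r) \<le> ennreal (c0 * r powr \<alpha>)" using bounds[of r x] r True by auto
      also have "\<dots> \<le> ennreal (c * r powr \<alpha>)" using c_ge0 by (intro ennreal_leI mult_right_mono) auto
      finally show ?thesis .
    next
      case False
      then obtain R where R: "qdiam d UNIV = ennreal R" "0 < R" "R \<le> r"
        using nontrivial r by (cases "qdiam d UNIV") (auto simp: not_less)
      have "d x y \<le> R" for y
        using qdiam_ge[of x y] R d(1) by simp
      then have "qball d x r \<subseteq> qball d x (2 * (2 * (R / 2)))"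
      proof -
        have "d x y < 2 * R" for y using \<open>\<And>y. d x y \<le> R\<close>[of y] R(2) by simp
        then show ?thesis by (auto simp: qball_def)
      qed
      then have "emeasure \<mu> (qball d x r) \<le> emeasure \<mu> (qball d x (2 * (2 * (R / 2))))"
        by (rule emeasure_mono) simp
      also have "\<dots> \<le> ennreal A * emeasure \<mu> (qball d x (2 * (R / 2)))" 
        using A[of "2 * (R / 2)" x] R by simp
      also have "\<dots> \<le> ennreal A * (ennreal A * emeasure \<mu> (qball d x (R / 2)))"
        using A[of "R / 2" x] R by (intro mult_left_mono) auto
      also have "\<dots> \<le> ennreal A * (ennreal A * ennreal (c0 * (R / 2) powr \<alpha>))"
        using bounds[of "R / 2" x] R by (intro mult_left_mono) (auto simp: ennreal_less_iff)
      also have "\<dots> \<le> ennreal (c * r powr \<alpha>)"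
      proof (cases "A \<le> 0")
        case True
        then show ?thesis by (simp add: ennreal_neg)
      next
        case False
        have "(R / 2) powr \<alpha> \<le> r powr \<alpha>" using R \<alpha> by (intro powr_mono2) auto
        then have "A * (A * (c0 * (R / 2) powr \<alpha>)) \<le> (A * A) * (c0 * r powr \<alpha>)"
          using False c0 by (simp add: mult.assoc mult_left_mono)
        also have "\<dots> \<le> max 1 (A * A) * ((2 powr \<alpha> * c0) * r powr \<alpha>)"
          using c0 two by (intro mult_mono mult_right_mono) (auto simp: mult_le_cancel_right1)
        also have "\<dots> = c * r powr \<alpha>" by (simp add: c_def mult_ac)
        finally show ?thesis using False c0
          by (simp add: ennreal_mult'[symmetric] ennreal_leI)
      qed
      finally show ?thesis .
    qed
  qed (use assms sets_\<mu> \<alpha> nontrivial in auto)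
qed

text \<open>An \<open>A\<^sub>1\<close> condition for weights bounded below by \<open>1\<close>: on each ball the mean is controlled by a lower
bound \<open>m\<close> of the weight that holds at every point, not only almost everywhere. The number \<open>m\<close> is
real and positive, so products with negative powers of \<open>m\<close> never meet the ambiguity \<open>0 * \<infinity>\<close>.\<close>

definition A1_minorant :: "('a \<Rightarrow> 'a \<Rightarrow> real) \<Rightarrow> 'a measure \<Rightarrow> ('a \<Rightarrow> ennreal) \<Rightarrow> bool" where
  "A1_minorant d \<mu> w \<longleftrightarrow> w \<in> borel_measurable \<mu> \<and>
     (\<exists>C\<ge>0. \<forall>x. \<forall>r>0. \<exists>m\<ge>1. (\<forall>y\<in>qball d x r. ennreal m \<le> w y) \<and>
        (\<integral>\<^sup>+y\<in>qball d x r. w y \<partial>\<mu>) \<le> ennreal (C * m) * emeasure \<mu> (qball d x r))"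

section \<open>Lower-dimensional subsets\<close>

locale regular_subset = ahlfors_regular d K \<alpha> \<mu> c
  for d :: "'a \<Rightarrow> 'a \<Rightarrow> real" and K \<alpha> :: real and \<mu> :: "'a measure" and c :: real +
  fixes E :: "'a set" and s :: real and \<nu> :: "'a measure" and k r\<^sub>0 :: real
  assumes closed: "closedin (qtop d) E"
    and bounded: "qdiam d E < \<infinity>"
    and s_nonneg: "0 \<le> s" and s_less: "s < \<alpha>"
    and \<nu>_borel: "borel_measure_finite_on_balls d \<nu>"
    and \<nu>_support: "AE x in \<nu>. x \<in> E"
    and r\<^sub>0_pos: "0 < r\<^sub>0" and k_ge_1: "1 \<le> k"
    and \<nu>_ball_lower: "x \<in> E \<Longrightarrow> 0 < r \<Longrightarrow> r < r\<^sub>0 \<Longrightarrow> ennreal (r powr s / k) \<le> emeasure \<nu> (qball d x r)"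
    and \<nu>_ball_upper: "x \<in> E \<Longrightarrow> 0 < r \<Longrightarrow> r < r\<^sub>0 \<Longrightarrow> emeasure \<nu> (qball d x r) \<le> ennreal (k * r powr s)"
begin

lemma k_pos [simp]: "0 < k" "0 \<le> k" "k \<noteq> 0"
  using k_ge_1 by auto

lemma sets_\<nu> [measurable_cong]: "sets \<nu> = sets \<mu>"
  using \<nu>_borel by (simp add: borel_measure_finite_on_balls_def sets_\<mu>)

lemma space_\<nu> [simp]: "space \<nu> = UNIV"
  using sets_eq_imp_space_eq[OF sets_\<nu>] by simp

lemma bounded_subset_ball: "\<exists>R>0. E \<subseteq> qball d p R"
proof (cases "E = {}")
  case False
  then obtain z where z: "z \<in> E" by blast
  obtain t where t: "qdiam d E = ennreal t" "0 \<le> t"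
    using bounded by (cases "qdiam d E") auto
  define R where "R = K * (d p z + 1 + (t + 1))"
  have "E \<subseteq> qball d z (t + 1)"
  proof
    fix y assume "y \<in> E"
    then have "ennreal (d z y) \<le> qdiam d E"
      unfolding qdiam_def using z by (intro order_trans[OF _ SUP_upper[of z]] SUP_upper) auto
    then show "y \<in> qball d z (t + 1)" using t by (simp add: qball_def)
  qed
  also have "\<dots> \<subseteq> qball d p R" by (rule qball_subset[of p z "d p z + 1"]) (auto simp: R_def)
  finally have "E \<subseteq> qball d p R" .
  moreover have "0 < R" using t d_nonneg[of p z] by (simp add: R_def add_pos_nonneg add_nonneg_pos del: d_nonneg)
  ultimately show ?thesis by blast
qed (auto intro: exI[of _ 1])

lemma \<nu>_UNIV_le: "E \<subseteq> qball d x r \<Longrightarrow> emeasure \<nu> UNIV \<le> emeasure \<nu> (qball d x r)"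
  by (rule emeasure_mono_AE) (use \<nu>_support in \<open>auto simp: sets_\<nu> elim!: eventually_mono\<close>)

lemma \<nu>_total: "\<exists>T>0. \<forall>A. emeasure \<nu> A \<le> ennreal T"
proof -
  fix p :: 'a
  obtain R where R: "E \<subseteq> qball d p R" using bounded_subset_ball by blast
  note \<nu>_UNIV_le[OF R]
  also have "emeasure \<nu> (qball d p R) < top"
    using \<nu>_borel by (simp add: borel_measure_finite_on_balls_def)
  finally obtain t where t: "emeasure \<nu> UNIV = ennreal t" "0 \<le> t" by (cases "emeasure \<nu> UNIV") auto
  have "emeasure \<nu> A \<le> ennreal (t + 1)" for A
    using emeasure_space[of \<nu> A] t by (auto intro: order_trans ennreal_leI)
  then show ?thesis using t by (intro exI[of _ "t + 1"]) auto
qed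

lemma \<nu>_ball_eq_0: "ennreal r \<le> qdist d x E \<Longrightarrow> emeasure \<nu> (qball d x r) = 0"
proof -
  assume "ennreal r \<le> qdist d x E"
  then have "y \<notin> qball d x r" if "y \<in> E" for y
    using that qdist_less_ennreal_iff[of x E r] by (auto simp: qball_def not_less[symmetric])
  then have "AE y in \<nu>. \<not> y \<in> qball d x r" using \<nu>_support by (auto elim: eventually_mono)
  from emeasure_eq_0_AE[OF this] show ?thesis by simp
qed

text \<open>The balls of radius \<open>t / (2K)\<close> around \<open>t\<close>-separated points are disjoint, and each carries at least
\<open>(t / (2K))\<^sup>s / k\<close> of the mass of \<open>V\<close>. This bounds the size of separated subsets of \<open>S\<close>; one of
maximal size is a net.\<close>

lemma separated_net:
  assumes t: "0 < t" "t < r\<^sub>0" and S: "S \<subseteq> E" and V: "V \<in> sets \<nu>" "(\<Union>z\<in>S. qball d z t) \<subseteq> V"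
    and q: "emeasure \<nu> V \<le> ennreal q" "0 \<le> q"
  obtains T where "finite T" "T \<subseteq> S" "real (card T) * (t / (2 * K)) powr s \<le> k * q"
    "\<And>z. z \<in> S \<Longrightarrow> \<exists>z'\<in>T. d z' z < t"
proof -
  define sep where "sep T \<longleftrightarrow> finite T \<and> T \<subseteq> S \<and> (\<forall>z\<in>T. \<forall>z'\<in>T. z \<noteq> z' \<longrightarrow> t \<le> d z z')" for T
  have u: "0 < t / (2 * K)" "t / (2 * K) < r\<^sub>0" "t / (2 * K) \<le> t"
    using t K_ge_1 by (auto simp: field_simps intro: order_less_le_trans)
  have bound: "real (card T) * (t / (2 * K)) powr s \<le> k * q" if T: "sep T" for T
  proof -
    have disj: "disjoint_family_on (\<lambda>z. qball d z (t / (2 * K))) T"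
      unfolding disjoint_family_on_def
    proof (intro ballI impI)
      fix z z' assume z: "z \<in> T" "z' \<in> T" "z \<noteq> z'"
      show "qball d z (t / (2 * K)) \<inter> qball d z' (t / (2 * K)) = {}"
      proof (rule ccontr)
        assume "qball d z (t / (2 * K)) \<inter> qball d z' (t / (2 * K)) \<noteq> {}"
        then obtain y where "d z y < t / (2 * K)" "d y z' < t / (2 * K)"
          by (auto simp: qball_def d_commute)
        from d_triangle_less[OF this] have "d z z' < t" by simp
        then show False using T z by (force simp: sep_def)
      qed
    qed
    have "ennreal (real (card T) * ((t / (2 * K)) powr s / k))
        = (\<Sum>z\<in>T. ennreal ((t / (2 * K)) powr s / k))"
      by (subst sum_ennreal) auto
    also have "\<dots> \<le> (\<Sum>z\<in>T. emeasure \<nu> (qball d z (t / (2 * K))))"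
      using T S u by (intro sum_mono \<nu>_ball_lower) (auto simp: sep_def)
    also have "\<dots> = emeasure \<nu> (\<Union>z\<in>T. qball d z (t / (2 * K)))"
      using T disj by (intro sum_emeasure) (auto simp: sep_def sets_\<nu>)
    also have "\<dots> \<le> emeasure \<nu> V"
    proof (intro emeasure_mono V(1) order_trans[OF _ V(2)])
      show "(\<Union>z\<in>T. qball d z (t / (2 * K))) \<subseteq> (\<Union>z\<in>S. qball d z t)"
        using T qball_mono[OF u(3)] by (auto simp: sep_def)
    qed
    finally have "real (card T) * ((t / (2 * K)) powr s / k) \<le> q"
      using q by (auto simp: ennreal_le_iff dest: order_trans)
    then show ?thesis by (simp add: field_simps)
  qed
  have "\<exists>T. sep T \<and> (\<forall>T'. sep T' \<longrightarrow> card T' \<le> card T)"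
  proof -
    define N where "N = nat \<lceil>k * q / (t / (2 * K)) powr s\<rceil>"
    have "card T \<le> N" if "sep T" for T
    proof -
      have "real (card T) \<le> k * q / (t / (2 * K)) powr s"
        using bound[OF that] u by (simp add: pos_le_divide_eq)
      also have "\<dots> \<le> real N" unfolding N_def by (rule real_nat_ceiling_ge)
      finally show ?thesis by simp
    qed
    moreover have "sep {}" by (simp add: sep_def)
    ultimately show ?thesis
      using ex_has_greatest_nat[of sep "{}" card "Suc N"] by (auto simp: less_Suc_eq_le)
  qed
  then obtain T where T: "sep T" and max: "\<And>T'. sep T' \<Longrightarrow> card T' \<le> card T" by blast
  show ?thesis
  proof (rule that[of T])
    fix z assume z: "z \<in> S"
    show "\<exists>z'\<in>T. d z' z < t"
    proof (rule ccontr)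
      assume "\<not> (\<exists>z'\<in>T. d z' z < t)"
      then have far: "\<And>z'. z' \<in> T \<Longrightarrow> t \<le> d z' z \<and> t \<le> d z z'" by (auto simp: not_less d_commute)
      have "z \<notin> T" using far[of z] t by auto
      moreover have "sep (insert z T)" using T far z by (auto simp: sep_def)
      ultimately show False using max[of "insert z T"] T by (simp add: sep_def)
    qed
  qed (use T bound in \<open>auto simp: sep_def\<close>)
qed

text \<open>The balls of radius \<open>2Kt\<close> around a \<open>t\<close>-net cover the \<open>t\<close>-neighbourhood; the net has at most
\<open>k q (t / (2K))\<^sup>-\<^sup>s\<close> points, and each ball has \<open>\<mu>\<close>-mass at most \<open>c (2Kt)\<^sup>\<alpha>\<close>.\<close>

lemma neighbourhood_measure:
  assumes t: "0 < t" "t < r\<^sub>0" and S: "S \<subseteq> E" and V: "V \<in> sets \<nu>" "(\<Union>z\<in>S. qball d z t) \<subseteq> V"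
    and q: "emeasure \<nu> V \<le> ennreal q" "0 \<le> q"
  shows "emeasure \<mu> (\<Union>z\<in>S. qball d z t) \<le> ennreal (c * k * (2 * K) powr (\<alpha> + s) * q * t powr (\<alpha> - s))"
proof -
  obtain T where T: "finite T" "T \<subseteq> S" and card: "real (card T) * (t / (2 * K)) powr s \<le> k * q"
    and net: "\<And>z. z \<in> S \<Longrightarrow> \<exists>z'\<in>T. d z' z < t"
    using separated_net[OF assms] by metis
  have "(\<Union>z\<in>S. qball d z t) \<subseteq> (\<Union>z\<in>T. qball d z (2 * K * t))"
  proof
    fix y assume "y \<in> (\<Union>z\<in>S. qball d z t)"
    then obtain z where z: "z \<in> S" "d z y < t" by (auto simp: qball_def)
    obtain z' where z': "z' \<in> T" "d z' z < t" using net[OF z(1)] by blast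
    show "y \<in> (\<Union>z\<in>T. qball d z (2 * K * t))"
      using d_triangle_less[OF z'(2) z(2)] z'(1) by (auto simp: qball_def algebra_simps)
  qed
  then have "emeasure \<mu> (\<Union>z\<in>S. qball d z t) \<le> emeasure \<mu> (\<Union>z\<in>T. qball d z (2 * K * t))"
    by (rule emeasure_mono) (use T in auto)
  also have "\<dots> \<le> (\<Sum>z\<in>T. emeasure \<mu> (qball d z (2 * K * t)))"
    by (rule emeasure_subadditive_finite) (use T in auto)
  also have "\<dots> \<le> (\<Sum>z\<in>T. ennreal (c * (2 * K * t) powr \<alpha>))"
    using t by (intro sum_mono \<mu>_ball_upper) auto
  also have "\<dots> = ennreal (real (card T) * (c * (2 * K * t) powr \<alpha>))"
    by (subst sum_ennreal) auto
  also have "\<dots> \<le> ennreal (c * k * (2 * K) powr (\<alpha> + s) * q * t powr (\<alpha> - s))"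
  proof (rule ennreal_leI)
    have "real (card T) * (c * (2 * K * t) powr \<alpha>)
        = real (card T) * (t / (2 * K)) powr s * (c * ((2 * K) powr (\<alpha> + s) * t powr (\<alpha> - s)))"
      using t by (simp add: powr_mult powr_divide powr_add powr_diff)
    also have "\<dots> \<le> k * q * (c * ((2 * K) powr (\<alpha> + s) * t powr (\<alpha> - s)))"
      by (rule mult_right_mono[OF card]) auto
    finally show "real (card T) * (c * (2 * K * t) powr \<alpha>)
        \<le> c * k * (2 * K) powr (\<alpha> + s) * q * t powr (\<alpha> - s)" by (simp add: mult_ac)
  qed
  finally show ?thesis .
qed

lemma level_set_measure:
  assumes t: "0 < t" "t < r\<^sub>0" and B: "B \<in> sets \<mu>"
    and V: "V \<in> sets \<nu>" "\<And>y z w. y \<in> B \<Longrightarrow> z \<in> E \<Longrightarrow> d y z < t \<Longrightarrow> d z w < t \<Longrightarrow> w \<in> V"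
    and q: "emeasure \<nu> V \<le> ennreal q" "0 \<le> q"
  shows "emeasure \<mu> {y \<in> B. qdist d y E < ennreal t}
    \<le> ennreal (c * k * (2 * K) powr (\<alpha> + s) * q * t powr (\<alpha> - s))"
proof -
  define S where "S = {z \<in> E. \<exists>y\<in>B. d y z < t}"
  have "openin (qtop d) (\<Union>z\<in>S. qball d z t)" using openin_ball by blast
  moreover have "{y \<in> B. qdist d y E < ennreal t} \<subseteq> (\<Union>z\<in>S. qball d z t)"
  proof
    fix y assume "y \<in> {y \<in> B. qdist d y E < ennreal t}"
    then obtain z where "y \<in> B" "z \<in> E" "d y z < t" by (auto simp: qdist_less_ennreal_iff)
    moreover from this have "d z y < t" by (simp add: d_commute)
    ultimately show "y \<in> (\<Union>z\<in>S. qball d z t)" by (auto simp: S_def qball_def)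
  qed
  ultimately have "emeasure \<mu> {y \<in> B. qdist d y E < ennreal t} \<le> emeasure \<mu> (\<Union>z\<in>S. qball d z t)"
    by (intro emeasure_mono sets_open)
  also have "\<dots> \<le> ennreal (c * k * (2 * K) powr (\<alpha> + s) * q * t powr (\<alpha> - s))"
    by (rule neighbourhood_measure[OF t _ V(1) _ q]) (use V(2) in \<open>auto simp: S_def qball_def\<close>)
  finally show ?thesis .
qed

subsection \<open>Integrals of negative powers of the distance\<close>

text \<open>For a small ball close to \<open>E\<close> the relevant \<open>\<nu>\<close>-mass is of order \<open>r\<^sup>s\<close>, so the sublevel sets of the
distance have measure of order \<open>r\<^sup>s t\<^sup>\<alpha>\<^sup>-\<^sup>s\<close> and the integral is of order
\<open>r\<^sup>s r\<^sup>\<alpha>\<^sup>-\<^sup>s\<^sup>+\<^sup>b = r\<^sup>b r\<^sup>\<alpha>\<close>.\<close>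

lemma near_ball_integral:
  assumes b: "b < 0" "0 < \<alpha> - s + b"
  shows "\<exists>C\<ge>0. \<exists>t>0. \<forall>x r. 0 < r \<longrightarrow> r < t \<longrightarrow> qdist d x E < ennreal (2 * K * r) \<longrightarrow>
    (\<forall>y\<in>qball d x r. qdist d y E < ennreal (3 * K\<^sup>2 * r)) \<and>
    (\<integral>\<^sup>+y\<in>qball d x r. epow (qdist d y E) b \<partial>\<mu>) \<le> ennreal (C * r powr b) * emeasure \<mu> (qball d x r)"
proof -
  define m where "m = 3 * K\<^sup>2"
  (* M r is the radius of a ball around a point of E which contains every point within t of a point
     of E that is itself within t of the ball of radius r, for all t up to m r. *)
  define M where "M = K * (2 * K + K * (K * (1 + m) + m))"
  define G where "G = 2 powr (- b) / (1 - 2 powr (- (\<alpha> - s + b)))"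
  define q0 where "q0 = c * k * (2 * K) powr (\<alpha> + s) * (k * M powr s)"
  define C where "C = G * q0 * m powr (\<alpha> - s + b) * c"
  define t where "t = min (r\<^sub>0 / (M + m)) D"
  have m: "0 < m" by (simp add: m_def)
  have M: "0 < M" unfolding M_def using m by (intro mult_pos_pos add_pos_pos) auto
  have G: "0 \<le> G" unfolding G_def using b by (auto intro!: divide_nonneg_nonneg simp: powr_less_one less_imp_le)
  have q0: "0 \<le> q0" unfolding q0_def using m M by auto
  have C: "0 \<le> C" unfolding C_def using q0 G by auto
  have t: "0 < t" unfolding t_def using r\<^sub>0_pos D_pos M m by auto
  show ?thesis
  proof (rule exI[of _ C], rule conjI[OF C], rule exI[of _ t], rule conjI[OF t], intro allI impI conjI)
    fix x r assume r: "0 < r" "r < t" and dist: "qdist d x E < ennreal (2 * K * r)"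
    have small: "M * r + m * r < r\<^sub>0" "r \<le> D"
      using r M m by (auto simp: t_def field_simps)
    have "0 < M * r" "0 < m * r" using r M m by auto
    then have Mr: "0 < M * r" "M * r < r\<^sub>0" "0 < m * r" "m * r < r\<^sub>0" using small by linarith+
    obtain z where z: "z \<in> E" "d x z < 2 * K * r" using dist by (auto simp: qdist_less_ennreal_iff)
    have B_near: "qdist d y E < ennreal (m * r)" if y: "y \<in> qball d x r" for y
    proof -
      have "d y x < r" using y by (simp add: qball_def d_commute)
      from d_triangle_less[OF this z(2)] have "d y z < K * (r + 2 * K * r)" .
      also have "\<dots> \<le> m * r"
      proof -
        have "K * r \<le> K * (K * r)" by (rule K_mult_ge) (use r in auto)
        then show ?thesis by (simp add: m_def power2_eq_square algebra_simps)
      qed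
      finally show ?thesis using z by (auto simp: qdist_less_ennreal_iff)
    qed
    then show "\<forall>y\<in>qball d x r. qdist d y E < ennreal (3 * K\<^sup>2 * r)" by (simp add: m_def)
    define Q where "Q = k * (M * r) powr s"
    have level: "emeasure \<mu> {y \<in> qball d x r. qdist d y E < ennreal u}
        \<le> ennreal (c * k * (2 * K) powr (\<alpha> + s) * Q * u powr (\<alpha> - s))"
      if u: "0 < u" "u \<le> m * r" for u
    proof (rule level_set_measure)
      show "0 < u" "u < r\<^sub>0" using u Mr by auto
      show "emeasure \<nu> (qball d z (M * r)) \<le> ennreal Q"
        unfolding Q_def using \<nu>_ball_upper z Mr by auto
      show "0 \<le> Q" by (simp add: Q_def)
      show "qball d z (M * r) \<in> sets \<nu>" by (simp add: sets_\<nu>)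
      fix y z' w assume y: "y \<in> qball d x r" "z' \<in> E" "d y z' < u" "d z' w < u"
      have "d x y < r" "d y z' < m * r" "d z' w < m * r" "d z x < 2 * K * r"
        using y u z by (auto simp: qball_def d_commute)
      then have "d z w < K * (2 * K * r + K * (K * (r + m * r) + m * r))"
        by (intro d_triangle_less[of z x _ w] d_triangle_less[of x z' _ w] d_triangle_less[of x y _ z'])
      also have "\<dots> = M * r" by (simp add: M_def algebra_simps)
      finally show "w \<in> qball d z (M * r)" by (simp add: qball_def)
    qed simp
    have "{y \<in> qball d x r. qdist d y E < ennreal (m * r)} = qball d x r" using B_near by auto
    then have "(\<integral>\<^sup>+y\<in>qball d x r. epow (qdist d y E) b \<partial>\<mu>)
        = (\<integral>\<^sup>+y\<in>{y \<in> qball d x r. qdist d y E < ennreal (m * r)}. epow (qdist d y E) b \<partial>\<mu>)"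
      by simp
    also have "\<dots> \<le> ennreal (G * (c * k * (2 * K) powr (\<alpha> + s) * Q) * (m * r) powr (\<alpha> - s + b))"
      unfolding G_def
      by (rule nn_integral_power_dyadic) (use b Mr level in \<open>auto simp: Q_def\<close>)
    also have "G * (c * k * (2 * K) powr (\<alpha> + s) * Q) * (m * r) powr (\<alpha> - s + b)
        = C * r powr b * (r powr \<alpha> / c)"
      using r M m by (simp add: C_def q0_def Q_def powr_mult powr_add powr_diff)
    also have "ennreal (C * r powr b * (r powr \<alpha> / c)) = ennreal (C * r powr b) * ennreal (r powr \<alpha> / c)"
      using C by (intro ennreal_mult) auto
    also have "\<dots> \<le> ennreal (C * r powr b) * emeasure \<mu> (qball d x r)"
      using r small by (intro mult_left_mono \<mu>_ball_lower') auto
    finally show "(\<integral>\<^sup>+y\<in>qball d x r. epow (qdist d y E) b \<partial>\<mu>)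
      \<le> ennreal (C * r powr b) * emeasure \<mu> (qball d x r)" .
  qed
qed

text \<open>The local mass bounds of \<open>\<nu>\<close> are of no use at large radii, but there the whole neighbourhood of \<open>E\<close>
contributes only a fixed amount, as \<open>\<nu>\<close> has finite total mass.\<close>

lemma large_ball_integral:
  assumes b: "b < 0" "0 < \<alpha> - s + b" and t: "0 < t"
  shows "\<exists>C\<ge>0. \<forall>x r. t \<le> r \<longrightarrow>
    (\<integral>\<^sup>+y\<in>qball d x r. epow (qdist d y E) b \<partial>\<mu>) \<le> ennreal C * emeasure \<mu> (qball d x r)"
proof -
  define G where "G = 2 powr (- b) / (1 - 2 powr (- (\<alpha> - s + b)))"
  have G: "0 \<le> G" unfolding G_def using b by (auto intro!: divide_nonneg_nonneg simp: powr_less_one less_imp_le)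
  obtain T where T: "0 < T" "\<And>A. emeasure \<nu> A \<le> ennreal T" using \<nu>_total by blast
  obtain l where l: "0 < l" "\<And>x r. t \<le> r \<Longrightarrow> ennreal l \<le> emeasure \<mu> (qball d x r)"
    using \<mu>_ball_ge[OF t] by blast
  define u where "u = r\<^sub>0 / 2"
  have u: "0 < u" "u < r\<^sub>0" using r\<^sub>0_pos by (auto simp: u_def)
  define I where "I = G * (c * k * (2 * K) powr (\<alpha> + s) * T) * u powr (\<alpha> - s + b)"
  have I: "0 \<le> I" unfolding I_def using G T by auto
  show ?thesis
  proof (intro exI[of _ "I / l + u powr b"] conjI allI impI)
    show "0 \<le> I / l + u powr b" using I l by auto
    fix x r assume r: "t \<le> r"
    define B where "B = qball d x r"
    have [measurable]: "B \<in> sets \<mu>" by (simp add: B_def)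
    have meas [measurable]: "{y \<in> B. qdist d y E < ennreal u} \<in> sets \<mu>"
    proof -
      have "{y \<in> B. qdist d y E < ennreal u} = B \<inter> {y \<in> space \<mu>. qdist d y E < ennreal u}" by auto
      then show ?thesis by simp
    qed
    have "(\<integral>\<^sup>+y\<in>B. epow (qdist d y E) b \<partial>\<mu>)
      \<le> (\<integral>\<^sup>+y. epow (qdist d y E) b * indicator {y \<in> B. qdist d y E < ennreal u} y
            + ennreal (u powr b) * indicator B y \<partial>\<mu>)"
    proof (rule nn_integral_mono)
      fix y
      show "epow (qdist d y E) b * indicator B y
        \<le> epow (qdist d y E) b * indicator {y \<in> B. qdist d y E < ennreal u} y
            + ennreal (u powr b) * indicator B y"
      proof (cases "y \<in> B \<and> \<not> qdist d y E < ennreal u")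
        case True
        then have "epow (qdist d y E) b \<le> epow (ennreal u) b"
          using b by (intro epow_antimono) auto
        then show ?thesis using True u by (simp add: epow_ennreal)
      qed (auto simp: indicator_def)
    qed
    also have "\<dots> = (\<integral>\<^sup>+y\<in>{y \<in> B. qdist d y E < ennreal u}. epow (qdist d y E) b \<partial>\<mu>)
        + ennreal (u powr b) * emeasure \<mu> B"
      by (subst nn_integral_add) (auto simp: nn_integral_cmult_indicator)
    also have "(\<integral>\<^sup>+y\<in>{y \<in> B. qdist d y E < ennreal u}. epow (qdist d y E) b \<partial>\<mu>) \<le> ennreal I"
      unfolding I_def G_def
    proof (rule nn_integral_power_dyadic)
      fix v assume v: "0 < v" "v \<le> u"
      show "emeasure \<mu> {y \<in> B. qdist d y E < ennreal v}
          \<le> ennreal (c * k * (2 * K) powr (\<alpha> + s) * T * v powr (\<alpha> - s))"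
      proof (rule level_set_measure[where V = UNIV])
        show "UNIV \<in> sets \<nu>" using sets.top[of \<nu>] by simp
      qed (use v u T in auto)
    qed (use b u T in auto)
    also have "ennreal I = ennreal (I / l) * ennreal l"
      using l I by (simp add: ennreal_mult[symmetric])
    also have "\<dots> \<le> ennreal (I / l) * emeasure \<mu> B"
      using l(2)[OF r] unfolding B_def by (intro mult_left_mono) auto
    finally show "(\<integral>\<^sup>+y\<in>qball d x r. epow (qdist d y E) b \<partial>\<mu>)
        \<le> ennreal (I / l + u powr b) * emeasure \<mu> (qball d x r)"
      using I l by (simp add: B_def ennreal_plus distrib_right add_right_mono)
  qed
qed

text \<open>Adding \<open>1\<close> makes large balls harmless: there \<open>m = 1\<close> suffices. A small ball either has \<open>\<rho>(x) < 2Kr\<close>,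
where the mean of \<open>\<rho>\<^sup>b\<close> is of order \<open>r\<^sup>b\<close> and \<open>\<rho> \<le> 3K\<^sup>2r\<close> throughout, or is so far from \<open>E\<close> that
\<open>\<rho>(x) / (2K) \<le> \<rho> \<le> 2K\<rho>(x)\<close> on it, so that \<open>\<rho>\<^sup>b\<close> is nearly constant.\<close>

lemma A1_minorant_power:
  assumes b: "b \<le> 0" "- (\<alpha> - s) < b"
  shows "A1_minorant d \<mu> (\<lambda>x. 1 + epow (qdist d x E) b)"
proof (cases "b = 0 \<or> E = {}")
  case True
  then consider "b = 0" | "E = {}" "b < 0" using b(1) by (metis less_eq_real_def)
  then obtain n :: real where n: "1 \<le> n" "\<And>x. 1 + epow (qdist d x E) b = ennreal n"
  proof cases
    case 1
    then show ?thesis by (intro that[of 2]) auto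
  qed (use that[of 1] in \<open>auto simp: epow_top_neg\<close>)
  then show ?thesis
    unfolding A1_minorant_def
    by (intro conjI exI[of _ n] allI impI exI[of _ 1]) (auto simp: nn_integral_cmult_indicator ennreal_leI)
next
  case False
  then have b: "b < 0" "0 < \<alpha> - s + b" and ne: "E \<noteq> {}" using b by auto
  obtain Cn t where Cn: "0 \<le> Cn" and t: "0 < t"
    and near_int: "\<And>x r. 0 < r \<Longrightarrow> r < t \<Longrightarrow> qdist d x E < ennreal (2 * K * r) \<Longrightarrow>
      (\<forall>y\<in>qball d x r. qdist d y E < ennreal (3 * K\<^sup>2 * r)) \<and>
      (\<integral>\<^sup>+y\<in>qball d x r. epow (qdist d y E) b \<partial>\<mu>) \<le> ennreal (Cn * r powr b) * emeasure \<mu> (qball d x r)"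
    using near_ball_integral[OF b] by blast
  obtain Cl where Cl: "0 \<le> Cl" and large_int: "\<And>x r. t \<le> r \<Longrightarrow>
      (\<integral>\<^sup>+y\<in>qball d x r. epow (qdist d y E) b \<partial>\<mu>) \<le> ennreal Cl * emeasure \<mu> (qball d x r)"
    using large_ball_integral[OF b t] by blast
  define n where "n = (3 * K\<^sup>2) powr (- b)"
  define f where "f = (4 * K\<^sup>2) powr (- b)"
  define C where "C = 1 + Cl + Cn * n + f"
  have nf: "0 \<le> n" "0 \<le> f" by (auto simp: n_def f_def)
  have C: "0 \<le> C" using Cl Cn nf by (simp add: C_def)
  have "\<exists>m\<ge>1. (\<forall>y\<in>qball d x r. ennreal m \<le> 1 + epow (qdist d y E) b) \<and>
      (\<integral>\<^sup>+y\<in>qball d x r. 1 + epow (qdist d y E) b \<partial>\<mu>) \<le> ennreal (C * m) * emeasure \<mu> (qball d x r)"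
    if r: "0 < r" for x r
  proof -
    let ?\<mu>B = "emeasure \<mu> (qball d x r)"
    have split: "(\<integral>\<^sup>+y\<in>qball d x r. 1 + epow (qdist d y E) b \<partial>\<mu>)
        = ?\<mu>B + (\<integral>\<^sup>+y\<in>qball d x r. epow (qdist d y E) b \<partial>\<mu>)"
    proof -
      have "(\<integral>\<^sup>+y\<in>qball d x r. 1 + epow (qdist d y E) b \<partial>\<mu>)
          = (\<integral>\<^sup>+y. indicator (qball d x r) y + epow (qdist d y E) b * indicator (qball d x r) y \<partial>\<mu>)"
        by (intro nn_integral_cong) (auto simp: distrib_right)
      also have "\<dots> = ?\<mu>B + (\<integral>\<^sup>+y\<in>qball d x r. epow (qdist d y E) b \<partial>\<mu>)"
        by (subst nn_integral_add) auto
      finally show ?thesis .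
    qed
    have key: ?thesis if p: "0 \<le> p"
      and low: "\<And>y. y \<in> qball d x r \<Longrightarrow> ennreal p \<le> epow (qdist d y E) b"
      and upp: "(\<integral>\<^sup>+y\<in>qball d x r. epow (qdist d y E) b \<partial>\<mu>) \<le> ennreal (A * p + A') * ?\<mu>B"
      and A: "0 \<le> A" "0 \<le> A'" "1 + A + A' \<le> C" for p A A'
    proof (intro exI[of _ "1 + p"] conjI ballI)
      show "1 \<le> 1 + p" using p by simp
      show "ennreal (1 + p) \<le> 1 + epow (qdist d y E) b" if "y \<in> qball d x r" for y
        using low[OF that] p by (simp add: ennreal_plus)
      have "(\<integral>\<^sup>+y\<in>qball d x r. 1 + epow (qdist d y E) b \<partial>\<mu>) \<le> ennreal 1 * ?\<mu>B + ennreal (A * p + A') * ?\<mu>B"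
        unfolding split using upp by simp
      also have "\<dots> = ennreal (1 + (A * p + A')) * ?\<mu>B"
        using A p by (subst ennreal_plus) (auto simp: distrib_right)
      also have "\<dots> \<le> ennreal (C * (1 + p)) * ?\<mu>B"
      proof (intro mult_right_mono ennreal_leI)
        have "(1 + A + A') * (1 + p) \<le> C * (1 + p)" using A p by (intro mult_right_mono) auto
        moreover have "1 + (A * p + A') \<le> (1 + A + A') * (1 + p)"
          using A p by (simp add: algebra_simps)
        ultimately show "1 + (A * p + A') \<le> C * (1 + p)" by linarith
      qed simp
      finally show "(\<integral>\<^sup>+y\<in>qball d x r. 1 + epow (qdist d y E) b \<partial>\<mu>) \<le> ennreal (C * (1 + p)) * ?\<mu>B" .
    qed
    consider (large) "t \<le> r" | (near) "r < t" "qdist d x E < ennreal (2 * K * r)"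
      | (far) e where "r < t" "qdist d x E = ennreal e" "2 * K * r \<le> e"
      using qdist_finite[OF ne, of x] r by (cases "qdist d x E") (fastforce simp: ennreal_less_iff not_less)+
    then show ?thesis
    proof cases
      case large
      show ?thesis
        by (rule key[of 0 0 Cl]) (use large_int[OF large] Cl Cn nf in \<open>auto simp: C_def\<close>)
    next
      case near
      note nb = near_int[OF r near]
      have pos: "0 < 3 * K\<^sup>2 * r" using r by simp
      have eq: "Cn * r powr b = Cn * n * (3 * K\<^sup>2 * r) powr b + 0"
        using r by (simp add: n_def powr_mult powr_minus field_simps)
      show ?thesis
      proof (rule key[of "(3 * K\<^sup>2 * r) powr b" "Cn * n" 0])
        show "ennreal ((3 * K\<^sup>2 * r) powr b) \<le> epow (qdist d y E) b" if "y \<in> qball d x r" for y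
          unfolding epow_ennreal[OF pos, symmetric]
          using nb that b by (intro epow_antimono) (auto intro: less_imp_le)
      qed (use nb Cl Cn nf eq in \<open>auto simp: C_def\<close>)
    next
      case far
      have e: "0 < e" using far(3) r by (meson K_pos(1) less_le_trans mult_pos_pos zero_less_numeral)
      have upper: "qdist d y E \<le> ennreal (2 * K * e)" if "y \<in> qball d x r" for y
      proof -
        have "qdist d y E \<le> ennreal K * (ennreal (d y x) + ennreal e)"
          using qdist_triangle[of y E x] far by simp
        also have "\<dots> = ennreal (K * (d y x + e))"
          using e by (simp add: ennreal_mult ennreal_plus)
        also have "\<dots> \<le> ennreal (2 * K * e)"
        proof (rule ennreal_leI)
          have "d y x \<le> r" using that by (simp add: qball_def d_commute)
          also have "r \<le> 2 * K * r" using K_mult_ge[of r] r by simp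
          also have "\<dots> \<le> e" by (rule far)
          finally show "K * (d y x + e) \<le> 2 * K * e" by (simp add: algebra_simps)
        qed
        finally show ?thesis .
      qed
      have lower: "ennreal (e / (2 * K)) \<le> qdist d y E" if "y \<in> qball d x r" for y
      proof (rule ccontr)
        assume "\<not> ennreal (e / (2 * K)) \<le> qdist d y E"
        then obtain z where z: "z \<in> E" "d y z < e / (2 * K)"
          by (auto simp: not_le qdist_less_ennreal_iff)
        have "r \<le> e / (2 * K)" using far(3) by (simp add: field_simps)
        then have "d x y < e / (2 * K)" using that by (simp add: qball_def)
        from d_triangle_less[OF this z(2)] have "d x z < e" by simp
        then have "qdist d x E < ennreal e" using z(1) by (auto simp: qdist_less_ennreal_iff)
        then show False using far by simp
      qed
      have pos: "0 < 2 * K * e" "0 < e / (2 * K)" using e by auto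
      have eq: "(e / (2 * K)) powr b = f * (2 * K * e) powr b"
      proof -
        have "e / (2 * K) = (2 * K * e) / (4 * K\<^sup>2)" by (simp add: field_simps power2_eq_square)
        then have "(e / (2 * K)) powr b = (2 * K * e) powr b / (4 * K\<^sup>2) powr b"
          by (simp only: powr_divide)
        then show ?thesis by (simp only: f_def powr_minus divide_inverse mult.commute)
      qed
      show ?thesis
      proof (rule key[of "(2 * K * e) powr b" f 0])
        show "ennreal ((2 * K * e) powr b) \<le> epow (qdist d y E) b" if "y \<in> qball d x r" for y
          unfolding epow_ennreal[OF pos(1), symmetric]
          using upper[OF that] b by (intro epow_antimono) auto
        have "(\<integral>\<^sup>+y\<in>qball d x r. epow (qdist d y E) b \<partial>\<mu>)
            \<le> (\<integral>\<^sup>+y. ennreal (f * (2 * K * e) powr b) * indicator (qball d x r) y \<partial>\<mu>)"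
        proof (rule nn_integral_mono)
          fix y
          show "epow (qdist d y E) b * indicator (qball d x r) y
              \<le> ennreal (f * (2 * K * e) powr b) * indicator (qball d x r) y"
            unfolding eq[symmetric] epow_ennreal[OF pos(2), symmetric]
            using lower[of y] b by (auto simp: indicator_def intro!: epow_antimono)
        qed
        also have "\<dots> = ennreal (f * (2 * K * e) powr b) * ?\<mu>B"
          by (simp add: nn_integral_cmult_indicator)
        finally show "(\<integral>\<^sup>+y\<in>qball d x r. epow (qdist d y E) b \<partial>\<mu>)
            \<le> ennreal (f * (2 * K * e) powr b + 0) * ?\<mu>B" by simp
      qed (use Cl Cn nf in \<open>auto simp: C_def\<close>)
    qed
  qed
  then show ?thesis unfolding A1_minorant_def using C by auto
qed

subsection \<open>The maximal function of one piece\<close>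

text \<open>Where \<open>\<rho>(x) = 0\<close> the right-hand side is infinite, and where \<open>r \<le> \<rho>(x)\<close> the left-hand side is zero.
Otherwise a small ball is contained in a ball of radius \<open>2Kr\<close> centred in \<open>E\<close>, and
\<open>r\<^sup>s\<^sup>-\<^sup>\<alpha> \<le> \<rho>(x)\<^sup>s\<^sup>-\<^sup>\<alpha>\<close>.\<close>

lemma \<nu>_ball_le:
  "\<exists>C\<ge>0. \<forall>x r. 0 < r \<longrightarrow>
    emeasure \<nu> (qball d x r) \<le> ennreal C * (1 + epow (qdist d x E) (s - \<alpha>)) * emeasure \<mu> (qball d x r)"
proof -
  obtain T where T: "0 < T" "\<And>A. emeasure \<nu> A \<le> ennreal T" using \<nu>_total by blast
  define t where "t = min (r\<^sub>0 / (2 * K)) D"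
  have t: "0 < t" using r\<^sub>0_pos by (simp add: t_def)
  obtain l where l: "0 < l" "\<And>x r. t \<le> r \<Longrightarrow> ennreal l \<le> emeasure \<mu> (qball d x r)"
    using \<mu>_ball_ge[OF t] by blast
  define A where "A = k * (2 * K) powr s * c"
  have A: "0 < A" by (simp add: A_def)
  have C: "0 < A + T / l" using A T l by (simp add: add_pos_pos)
  have "emeasure \<nu> (qball d x r)
      \<le> ennreal (A + T / l) * (1 + epow (qdist d x E) (s - \<alpha>)) * emeasure \<mu> (qball d x r)"
    if r: "0 < r" for x r
  proof -
    consider (zero) "qdist d x E = 0" | (out) "ennreal r \<le> qdist d x E"
      | (large) "t \<le> r" | (small) e where "0 < e" "qdist d x E = ennreal e" "e < r" "r < t"
      using r by (cases "qdist d x E" rule: ennreal_trichotomy) (auto simp: ennreal_less_iff not_le[symmetric])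
    then show ?thesis
    proof cases
      case zero
      then show ?thesis using s_less C \<mu>_ball_pos[OF r, of x]
        by (simp add: epow_0_neg ennreal_mult_top ennreal_top_mult)
    next
      case out
      then show ?thesis by (simp add: \<nu>_ball_eq_0)
    next
      case large
      have "emeasure \<nu> (qball d x r) \<le> ennreal (T / l) * ennreal l"
        using T l by (simp add: ennreal_mult[symmetric])
      also have "\<dots> \<le> ennreal (A + T / l) * (1 + epow (qdist d x E) (s - \<alpha>)) * emeasure \<mu> (qball d x r)"
      proof (intro mult_mono l(2)[OF large])
        have "ennreal (T / l) * 1 \<le> ennreal (A + T / l) * (1 + epow (qdist d x E) (s - \<alpha>))"
          using A by (intro mult_mono ennreal_leI) auto
        then show "ennreal (T / l) \<le> ennreal (A + T / l) * (1 + epow (qdist d x E) (s - \<alpha>))" by simp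
      qed auto
      finally show ?thesis .
    next
      case small
      then obtain z where z: "z \<in> E" "d x z < r"
        using qdist_less_ennreal_iff[of x E r] by (auto simp: ennreal_less_iff)
      have "d z x < r" using z(2) by (simp add: d_commute)
      have "qball d x r \<subseteq> qball d z (2 * K * r)"
        by (rule qball_subset[OF \<open>d z x < r\<close>]) (simp add: algebra_simps)
      then have "emeasure \<nu> (qball d x r) \<le> emeasure \<nu> (qball d z (2 * K * r))"
        by (rule emeasure_mono) (simp add: sets_\<nu>)
      also have "\<dots> \<le> ennreal (k * (2 * K * r) powr s)"
      proof (rule \<nu>_ball_upper[OF z(1)])
        have "r < r\<^sub>0 / (2 * K)" using small by (simp add: t_def)
        then show "2 * K * r < r\<^sub>0" by (simp add: field_simps)
      qed (use r in simp)
      also have "k * (2 * K * r) powr s = A * r powr (s - \<alpha>) * (r powr \<alpha> / c)"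
        using r by (simp add: A_def powr_mult powr_diff)
      also have "ennreal (A * r powr (s - \<alpha>) * (r powr \<alpha> / c))
          = ennreal A * ennreal (r powr (s - \<alpha>)) * ennreal (r powr \<alpha> / c)"
        by (intro ennreal_mult3) (use A in auto)
      also have "\<dots> \<le> ennreal (A + T / l) * (1 + epow (qdist d x E) (s - \<alpha>)) * emeasure \<mu> (qball d x r)"
      proof (intro mult_mono ennreal_leI)
        show "ennreal (r powr \<alpha> / c) \<le> emeasure \<mu> (qball d x r)"
          using r small by (intro \<mu>_ball_lower') (auto simp: t_def)
        have "ennreal (r powr (s - \<alpha>)) \<le> epow (qdist d x E) (s - \<alpha>)"
          unfolding small(2) epow_ennreal[OF small(1)]
          using small s_less by (intro ennreal_leI powr_mono2') auto
        also have "\<dots> \<le> 1 + epow (qdist d x E) (s - \<alpha>)" by simp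
        finally show "ennreal (r powr (s - \<alpha>)) \<le> 1 + epow (qdist d x E) (s - \<alpha>)" .
      qed (use T l in auto)
      finally show ?thesis .
    qed
  qed
  then show ?thesis using C less_imp_le by blast
qed

text \<open>A point \<open>z\<close> of \<open>E\<close> lies within \<open>2\<rho>(x)\<close> of \<open>x\<close>, and the ball of radius \<open>\<rho>(x)\<close> around \<open>z\<close> is contained
in the ball of radius \<open>3K\<rho>(x)\<close> around \<open>x\<close>.\<close>

lemma maximal_fun_lower:
  "\<exists>q>0. \<forall>x. 0 < qdist d x E \<longrightarrow> qdist d x E < ennreal r\<^sub>0 \<longrightarrow>
    ennreal q * epow (qdist d x E) (s - \<alpha>) \<le> maximal_fun d \<mu> \<nu> x"
proof (intro exI[of _ "1 / (k * c * (3 * K) powr \<alpha>)"] conjI allI impI)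
  show "0 < 1 / (k * c * (3 * K) powr \<alpha>)" by simp
  fix x assume x: "0 < qdist d x E" "qdist d x E < ennreal r\<^sub>0"
  then obtain e where e: "qdist d x E = ennreal e" "0 < e" "e < r\<^sub>0"
    by (cases "qdist d x E") (auto simp: ennreal_less_iff)
  then have "qdist d x E < ennreal (2 * e)" by (simp add: ennreal_less_iff)
  then obtain z where z: "z \<in> E" "d x z < 2 * e" by (auto simp: qdist_less_ennreal_iff)
  have "ennreal (e powr s / k) \<le> emeasure \<nu> (qball d z e)"
    by (rule \<nu>_ball_lower) (use z e in auto)
  also have "\<dots> \<le> emeasure \<nu> (qball d x (3 * K * e))"
    by (intro emeasure_mono qball_subset[OF z(2)]) (auto simp: algebra_simps sets_\<nu>)
  finally have "ennreal (e powr s / k / (c * (3 * K * e) powr \<alpha>)) \<le> maximal_fun d \<mu> \<nu> x"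
    using e by (intro maximal_fun_ge) auto
  also have "e powr s / k / (c * (3 * K * e) powr \<alpha>) = 1 / (k * c * (3 * K) powr \<alpha>) * e powr (s - \<alpha>)"
    using e by (simp add: powr_mult powr_diff)
  also have "ennreal \<dots> = ennreal (1 / (k * c * (3 * K) powr \<alpha>)) * epow (qdist d x E) (s - \<alpha>)"
    using e by (simp add: epow_ennreal ennreal_mult[symmetric])
  finally show "ennreal (1 / (k * c * (3 * K) powr \<alpha>)) * epow (qdist d x E) (s - \<alpha>)
      \<le> maximal_fun d \<mu> \<nu> x" .
qed

lemma \<nu>_pos: 
  assumes "E \<noteq> {}" shows "0 < emeasure \<nu> UNIV"
proof -
  obtain z where z: "z \<in> E" using assms by blast
  have "0 < ennreal ((r\<^sub>0 / 2) powr s / k)" using r\<^sub>0_pos by simp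
  also have "\<dots> \<le> emeasure \<nu> (qball d z (r\<^sub>0 / 2))"
    by (rule \<nu>_ball_lower[OF z]) (use r\<^sub>0_pos in auto)
  also have "\<dots> \<le> emeasure \<nu> UNIV" using emeasure_space[of \<nu>] by simp
  finally show ?thesis .
qed

end

section \<open>From \<open>A\<^sub>1\<close> minorants to Muckenhoupt weights\<close>

context ahlfors_regular begin

lemma ball_mean_le:
  assumes "0 < r" "(\<integral>\<^sup>+y\<in>qball d x r. w y \<partial>\<mu>) \<le> k * emeasure \<mu> (qball d x r)"
  shows "ball_mean d \<mu> w x r \<le> k"
  unfolding ball_mean_def
  using assms \<mu>_ball_pos by (intro divide_le_posI_ennreal) (auto simp: mult.commute)

lemma A1_minorant_imp_A1:
  assumes "A1_minorant d \<mu> w"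
  shows "muckenhoupt_A1 d \<mu> w"
proof -
  obtain C where C: "0 \<le> C" and w: "w \<in> borel_measurable \<mu>"
    and m: "\<And>x r. 0 < r \<Longrightarrow> \<exists>m\<ge>1. (\<forall>y\<in>qball d x r. ennreal m \<le> w y) \<and>
      (\<integral>\<^sup>+y\<in>qball d x r. w y \<partial>\<mu>) \<le> ennreal (C * m) * emeasure \<mu> (qball d x r)"
    using assms unfolding A1_minorant_def by blast
  have "(\<integral>\<^sup>+y\<in>qball d x r. w y \<partial>\<mu>) < top" if "0 < r" for x r
    using m[OF that] \<mu>_ball_finite[of x r]
    by (meson ennreal_less_top ennreal_mult_less_top order_le_less_trans)
  moreover have "ball_mean d \<mu> w x r \<le> ennreal C * w y" if r: "0 < r" and y: "y \<in> qball d x r" for x r y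
  proof -
    obtain m where m: "1 \<le> m" "\<forall>y\<in>qball d x r. ennreal m \<le> w y"
      "(\<integral>\<^sup>+y\<in>qball d x r. w y \<partial>\<mu>) \<le> ennreal (C * m) * emeasure \<mu> (qball d x r)"
      using m[OF r] by blast
    have "ball_mean d \<mu> w x r \<le> ennreal (C * m)" by (rule ball_mean_le[OF r m(3)])
    also have "\<dots> = ennreal C * ennreal m" using C m by (simp add: ennreal_mult)
    also have "\<dots> \<le> ennreal C * w y" using m y by (intro mult_left_mono) auto
    finally show ?thesis .
  qed
  ultimately show ?thesis
    unfolding muckenhoupt_A1_def weight_def
    by (intro conjI exI[of _ C] allI impI AE_I2) (use w in auto)
qed

text \<open>The easy half of Jones factorization: on a ball where \<open>m\<^sub>1 \<le> w\<^sub>1\<close> and \<open>m\<^sub>2 \<le> w\<^sub>2\<close>, replacing the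
factor with the negative exponent by its bound gives means at most \<open>C\<^sub>1 m\<^sub>1 m\<^sub>2\<^sup>1\<^sup>-\<^sup>p\<close> and
\<open>C\<^sub>2 m\<^sub>2 m\<^sub>1\<^sup>-\<^sup>1\<^sup>/\<^sup>(\<^sup>p\<^sup>-\<^sup>1\<^sup>)\<close>, and all powers of \<open>m\<^sub>1\<close> and \<open>m\<^sub>2\<close> cancel in the \<open>A\<^sub>p\<close> product. Both
factorizations are assumed as inequalities because \<open>0 * \<infinity> = 0\<close> could falsify one of them if \<open>w\<^sub>1\<close>
and \<open>w\<^sub>2\<close> were infinite at the same point.\<close>

lemma A1_minorants_imp_Ap:
  assumes p: "1 < p" and w1: "A1_minorant d \<mu> w1" and w2: "A1_minorant d \<mu> w2"
    and v [measurable]: "v \<in> borel_measurable \<mu>"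
    and v_le: "\<And>y. v y \<le> w1 y * epow (w2 y) (1 - p)"
    and dual_le: "\<And>y. epow (v y) (- 1 / (p - 1)) \<le> w2 y * epow (w1 y) (- 1 / (p - 1))"
  shows "muckenhoupt_Ap p d \<mu> v"
proof -
  define \<sigma> where "\<sigma> y = epow (v y) (- 1 / (p - 1))" for y
  define q where "q = - 1 / (p - 1)"
  have q: "q < 0" "q * (p - 1) = - 1" using p by (auto simp: q_def divide_neg_pos)
  have \<sigma>_meas [measurable]: "\<sigma> \<in> borel_measurable \<mu>" unfolding \<sigma>_def by measurable
  obtain C1 where C1: "0 \<le> C1" and [measurable]: "w1 \<in> borel_measurable \<mu>"
    and m1: "\<And>x r. 0 < r \<Longrightarrow> \<exists>m\<ge>1. (\<forall>y\<in>qball d x r. ennreal m \<le> w1 y) \<and>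
      (\<integral>\<^sup>+y\<in>qball d x r. w1 y \<partial>\<mu>) \<le> ennreal (C1 * m) * emeasure \<mu> (qball d x r)"
    using w1 unfolding A1_minorant_def by blast
  obtain C2 where C2: "0 \<le> C2" and [measurable]: "w2 \<in> borel_measurable \<mu>"
    and m2: "\<And>x r. 0 < r \<Longrightarrow> \<exists>m\<ge>1. (\<forall>y\<in>qball d x r. ennreal m \<le> w2 y) \<and>
      (\<integral>\<^sup>+y\<in>qball d x r. w2 y \<partial>\<mu>) \<le> ennreal (C2 * m) * emeasure \<mu> (qball d x r)"
    using w2 unfolding A1_minorant_def by blast
  have mixed: "(\<integral>\<^sup>+y\<in>qball d x r. u y \<partial>\<mu>) \<le> ennreal (n powr a * (C * m)) * emeasure \<mu> (qball d x r)"
    if "u \<in> borel_measurable \<mu>" and [measurable]: "w \<in> borel_measurable \<mu>"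
      and le: "\<And>y. u y \<le> w y * epow (w' y) a" and a: "a \<le> 0"
      and n: "1 \<le> n" "\<forall>y\<in>qball d x r. ennreal n \<le> w' y"
      and C: "0 \<le> C" "1 \<le> m" "(\<integral>\<^sup>+y\<in>qball d x r. w y \<partial>\<mu>) \<le> ennreal (C * m) * emeasure \<mu> (qball d x r)"
    for u w w' a n m C x r
  proof -
    have "(\<integral>\<^sup>+y\<in>qball d x r. u y \<partial>\<mu>) \<le> (\<integral>\<^sup>+y. ennreal (n powr a) * (w y * indicator (qball d x r) y) \<partial>\<mu>)"
    proof (rule nn_integral_mono)
      fix y
      show "u y * indicator (qball d x r) y \<le> ennreal (n powr a) * (w y * indicator (qball d x r) y)"
      proof (cases "y \<in> qball d x r")
        case True
        have "epow (w' y) a \<le> epow (ennreal n) a" using n(2) True a by (intro epow_antimono) auto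
        also have "\<dots> = ennreal (n powr a)" using n by (intro epow_ennreal) auto
        finally have "w y * epow (w' y) a \<le> w y * ennreal (n powr a)" by (rule mult_left_mono) simp
        then show ?thesis using le[of y] True by (auto simp: mult.commute intro: order_trans)
      qed simp
    qed
    also have "\<dots> = ennreal (n powr a) * (\<integral>\<^sup>+y\<in>qball d x r. w y \<partial>\<mu>)"
      by (rule nn_integral_cmult) measurable
    also have "\<dots> \<le> ennreal (n powr a) * (ennreal (C * m) * emeasure \<mu> (qball d x r))"
      by (rule mult_left_mono[OF C(3)]) simp
    also have "\<dots> = ennreal (n powr a * (C * m)) * emeasure \<mu> (qball d x r)"
      using C by (subst ennreal_mult) (auto simp: mult.assoc)
    finally show ?thesis .
  qed
  have est: "\<exists>m1\<ge>1. \<exists>m2\<ge>1.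
      (\<integral>\<^sup>+y\<in>qball d x r. v y \<partial>\<mu>) \<le> ennreal (m2 powr (1 - p) * (C1 * m1)) * emeasure \<mu> (qball d x r) \<and>
      (\<integral>\<^sup>+y\<in>qball d x r. \<sigma> y \<partial>\<mu>) \<le> ennreal (m1 powr q * (C2 * m2)) * emeasure \<mu> (qball d x r)"
    if r: "0 < r" for x r
  proof -
    obtain a where a: "1 \<le> a" "\<forall>y\<in>qball d x r. ennreal a \<le> w1 y"
      "(\<integral>\<^sup>+y\<in>qball d x r. w1 y \<partial>\<mu>) \<le> ennreal (C1 * a) * emeasure \<mu> (qball d x r)"
      using m1[OF r] by blast
    obtain b where b: "1 \<le> b" "\<forall>y\<in>qball d x r. ennreal b \<le> w2 y"
      "(\<integral>\<^sup>+y\<in>qball d x r. w2 y \<partial>\<mu>) \<le> ennreal (C2 * b) * emeasure \<mu> (qball d x r)"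
      using m2[OF r] by blast
    show ?thesis
    proof (rule exI[of _ a], rule conjI[OF a(1)], rule exI[of _ b], rule conjI[OF b(1)], rule conjI)
      show "(\<integral>\<^sup>+y\<in>qball d x r. v y \<partial>\<mu>) \<le> ennreal (b powr (1 - p) * (C1 * a)) * emeasure \<mu> (qball d x r)"
        by (rule mixed[OF v _ v_le _ b(1,2) C1 a(1,3)]) (use p in auto)
      show "(\<integral>\<^sup>+y\<in>qball d x r. \<sigma> y \<partial>\<mu>) \<le> ennreal (a powr q * (C2 * b)) * emeasure \<mu> (qball d x r)"
        by (rule mixed[OF \<sigma>_meas _ _ _ a(1,2) C2 b(1,3)])
          (use q dual_le in \<open>auto simp: \<sigma>_def q_def\<close>)
    qed
  qed
  have fin: "(\<integral>\<^sup>+y\<in>qball d x r. v y \<partial>\<mu>) < top" "(\<integral>\<^sup>+y\<in>qball d x r. \<sigma> y \<partial>\<mu>) < top" if "0 < r" for x r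
    using est[OF that, of x] \<mu>_ball_finite[of x r]
    by (meson ennreal_less_top ennreal_mult_less_top order_le_less_trans)+
  have "ball_mean d \<mu> v x r * epow (ball_mean d \<mu> \<sigma> x r) (p - 1) \<le> ennreal (C1 * C2 powr (p - 1))"
    if r: "0 < r" for x r
  proof -
    obtain a b where a: "1 \<le> a" and b: "1 \<le> b"
      and i1: "(\<integral>\<^sup>+y\<in>qball d x r. v y \<partial>\<mu>) \<le> ennreal (b powr (1 - p) * (C1 * a)) * emeasure \<mu> (qball d x r)"
      and i2: "(\<integral>\<^sup>+y\<in>qball d x r. \<sigma> y \<partial>\<mu>) \<le> ennreal (a powr q * (C2 * b)) * emeasure \<mu> (qball d x r)"
      using est[OF r] by blast
    have "ball_mean d \<mu> v x r * epow (ball_mean d \<mu> \<sigma> x r) (p - 1)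
        \<le> ennreal (b powr (1 - p) * (C1 * a)) * epow (ennreal (a powr q * (C2 * b))) (p - 1)"
      using p by (intro mult_mono ball_mean_le[OF r i1] epow_mono ball_mean_le[OF r i2]) auto
    also have "epow (ennreal (a powr q * (C2 * b))) (p - 1) = ennreal ((a powr q * (C2 * b)) powr (p - 1))"
    proof (cases "C2 = 0")
      case True
      then show ?thesis using p by (simp add: epow_def)
    qed (use C2 a b in \<open>auto intro!: epow_ennreal\<close>)
    also have "ennreal (b powr (1 - p) * (C1 * a)) * \<dots>
        = ennreal (b powr (1 - p) * (C1 * a) * (a powr q * (C2 * b)) powr (p - 1))"
      using C1 a by (subst ennreal_mult) auto
    also have "b powr (1 - p) * (C1 * a) * (a powr q * (C2 * b)) powr (p - 1)
        = (b powr (1 - p) * b powr (p - 1)) * (a powr 1 * a powr (q * (p - 1))) * (C1 * C2 powr (p - 1))"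
      using a b C2 by (simp add: powr_mult powr_powr)
    also have "\<dots> = C1 * C2 powr (p - 1)"
      using a b q by (simp flip: powr_add)
    finally show ?thesis .
  qed
  then show ?thesis
    unfolding muckenhoupt_Ap_def weight_def
    using fin v \<sigma>_meas by (auto simp: \<sigma>_def[abs_def])
qed

text \<open>The hypotheses say that \<open>v\<close> is comparable to the maximum of \<open>1\<close> and the \<open>w\<^sub>i\<close>. Hence the maximum of
\<open>1\<close> and the numbers \<open>m\<^sub>i / L\<close> is a lower bound of \<open>v\<close>, and it dominates, up to constants, each of
the finitely many means that bound the mean of \<open>v\<close>.\<close>

lemma A1_minorant_dominated:
  assumes I: "finite I" and w: "\<And>i. i \<in> I \<Longrightarrow> A1_minorant d \<mu> (w i)"
    and v: "v \<in> borel_measurable \<mu>" and v_ge: "\<And>y. 1 \<le> v y"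
    and v_le: "\<And>y. v y \<le> 1 + (\<Sum>i\<in>I. w i y)"
    and L: "1 \<le> L" "\<And>i y. i \<in> I \<Longrightarrow> w i y \<le> ennreal L * v y"
  shows "A1_minorant d \<mu> v"
proof -
  have meas: "\<And>i. i \<in> I \<Longrightarrow> w i \<in> borel_measurable \<mu>" using w by (simp add: A1_minorant_def)
  have "\<forall>i\<in>I. \<exists>C\<ge>0. \<forall>x. \<forall>r>0. \<exists>m\<ge>1. (\<forall>y\<in>qball d x r. ennreal m \<le> w i y) \<and>
        (\<integral>\<^sup>+y\<in>qball d x r. w i y \<partial>\<mu>) \<le> ennreal (C * m) * emeasure \<mu> (qball d x r)"
    using w by (simp add: A1_minorant_def)
  from bchoice[OF this] obtain C where C: "\<And>i. i \<in> I \<Longrightarrow> 0 \<le> C i"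
    and m: "\<And>i x r. i \<in> I \<Longrightarrow> 0 < r \<Longrightarrow> \<exists>m\<ge>1. (\<forall>y\<in>qball d x r. ennreal m \<le> w i y) \<and>
        (\<integral>\<^sup>+y\<in>qball d x r. w i y \<partial>\<mu>) \<le> ennreal (C i * m) * emeasure \<mu> (qball d x r)"
    by blast
  have "\<exists>n\<ge>1. (\<forall>y\<in>qball d x r. ennreal n \<le> v y) \<and>
        (\<integral>\<^sup>+y\<in>qball d x r. v y \<partial>\<mu>) \<le> ennreal ((1 + (\<Sum>i\<in>I. C i) * L) * n) * emeasure \<mu> (qball d x r)"
    if r: "0 < r" for x r
  proof -
    let ?B = "qball d x r"
    have "\<forall>i\<in>I. \<exists>m\<ge>1. (\<forall>y\<in>?B. ennreal m \<le> w i y) \<and>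
        (\<integral>\<^sup>+y\<in>?B. w i y \<partial>\<mu>) \<le> ennreal (C i * m) * emeasure \<mu> ?B" using m r by blast
    from bchoice[OF this] obtain n where n: "\<And>i. i \<in> I \<Longrightarrow> 1 \<le> n i" "\<And>i y. i \<in> I \<Longrightarrow> y \<in> ?B \<Longrightarrow> ennreal (n i) \<le> w i y"
      "\<And>i. i \<in> I \<Longrightarrow> (\<integral>\<^sup>+y\<in>?B. w i y \<partial>\<mu>) \<le> ennreal (C i * n i) * emeasure \<mu> ?B"
      by blast
    define N where "N = Max (insert 1 ((\<lambda>i. n i / L) ` I))"
    have N: "1 \<le> N" "\<And>i. i \<in> I \<Longrightarrow> n i / L \<le> N" using I by (auto simp: N_def intro!: Max_ge)
    show ?thesis
    proof (intro exI[of _ N] conjI ballI)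
      fix y assume y: "y \<in> ?B"
      have "N \<in> insert 1 ((\<lambda>i. n i / L) ` I)" unfolding N_def using I by (intro Max_in) auto
      then show "ennreal N \<le> v y"
      proof
        assume "N \<in> (\<lambda>i. n i / L) ` I"
        then obtain i where i: "i \<in> I" "N = n i / L" by blast
        have "ennreal L * ennreal N = ennreal (n i)" using i L n(1)[OF i(1)] by (simp add: ennreal_mult[symmetric])
        also have "\<dots> \<le> ennreal L * v y" using n(2)[OF i(1) y] L(2)[OF i(1)] by (rule order_trans)
        finally show ?thesis using L(1) by (subst (asm) ennreal_mult_le_mult_iff) auto
      qed (use v_ge in auto)
    next
      have "(\<integral>\<^sup>+y\<in>?B. v y \<partial>\<mu>) \<le> (\<integral>\<^sup>+y. indicator ?B y + (\<Sum>i\<in>I. w i y * indicator ?B y) \<partial>\<mu>)"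
      proof (rule nn_integral_mono)
        fix y show "v y * indicator ?B y \<le> indicator ?B y + (\<Sum>i\<in>I. w i y * indicator ?B y)"
          using v_le[of y] by (auto simp: indicator_def)
      qed
      also have "\<dots> = emeasure \<mu> ?B + (\<Sum>i\<in>I. \<integral>\<^sup>+y\<in>?B. w i y \<partial>\<mu>)"
        using meas by (subst nn_integral_add) (auto intro!: borel_measurable_sum simp: nn_integral_sum)
      also have "\<dots> \<le> emeasure \<mu> ?B + (\<Sum>i\<in>I. ennreal (C i * L * N) * emeasure \<mu> ?B)"
      proof (intro add_left_mono sum_mono)
        fix i assume i: "i \<in> I"
        have "n i \<le> L * N" using N(2)[OF i] L(1) by (simp add: field_simps)
        then have "C i * n i \<le> C i * L * N" using C[OF i] by (simp add: mult.assoc mult_left_mono)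
        then have "ennreal (C i * n i) * emeasure \<mu> ?B \<le> ennreal (C i * L * N) * emeasure \<mu> ?B"
          by (intro mult_right_mono ennreal_leI) auto
        then show "(\<integral>\<^sup>+y\<in>?B. w i y \<partial>\<mu>) \<le> ennreal (C i * L * N) * emeasure \<mu> ?B"
          using n(3)[OF i] by (rule order_trans[rotated])
      qed
      also have "\<dots> = ennreal (1 + (\<Sum>i\<in>I. C i * L * N)) * emeasure \<mu> ?B"
      proof -
        have nonneg: "\<And>i. i \<in> I \<Longrightarrow> 0 \<le> C i * L * N" using C L N(1) by simp
        then have "(\<Sum>i\<in>I. ennreal (C i * L * N) * emeasure \<mu> ?B) = ennreal (\<Sum>i\<in>I. C i * L * N) * emeasure \<mu> ?B"
          by (simp only: sum_distrib_right[symmetric] sum_ennreal)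
        then show ?thesis using nonneg by (subst ennreal_plus) (auto simp: sum_nonneg distrib_right)
      qed
      also have "\<dots> \<le> ennreal ((1 + (\<Sum>i\<in>I. C i) * L) * N) * emeasure \<mu> ?B"
      proof (intro mult_right_mono ennreal_leI)
        show "1 + (\<Sum>i\<in>I. C i * L * N) \<le> (1 + (\<Sum>i\<in>I. C i) * L) * N"
          using N(1) by (simp add: sum_distrib_right distrib_right)
      qed simp
      finally show "(\<integral>\<^sup>+y\<in>?B. v y \<partial>\<mu>) \<le> ennreal ((1 + (\<Sum>i\<in>I. C i) * L) * N) * emeasure \<mu> ?B" .
    qed (rule N(1))
  qed
  moreover have "0 \<le> 1 + (\<Sum>i\<in>I. C i) * L" using C L by (simp add: sum_nonneg add_nonneg_nonneg)
  ultimately show ?thesis unfolding A1_minorant_def using v by blast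
qed

end

section \<open>Finitely many separated pieces\<close>

text \<open>The width \<open>\<delta>\<close> of the neighbourhoods serves three purposes: \<open>\<delta> \<le> 1\<close> makes negative powers of the
distance at least \<open>1\<close> inside them, \<open>\<delta> \<le> r\<^sub>0\<close> keeps them within reach of the local mass bounds, and
the separation condition makes them disjoint.\<close>

locale regular_family = ahlfors_regular d K \<alpha> \<mu> c
  for d :: "'a \<Rightarrow> 'a \<Rightarrow> real" and K \<alpha> :: real and \<mu> :: "'a measure" and c :: real +
  fixes H :: nat and F :: "nat \<Rightarrow> 'a set" and s :: "nat \<Rightarrow> real" and \<nu>s :: "nat \<Rightarrow> 'a measure"
    and \<nu> :: "'a measure" and k r\<^sub>0 :: "nat \<Rightarrow> real" and \<delta> :: real
  assumes piece: "i \<in> {1..H} \<Longrightarrow> regular_subset d K \<alpha> \<mu> c (F i) (s i) (\<nu>s i) (k i) (r\<^sub>0 i)"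
    and sets_\<nu>: "sets \<nu> = sets \<mu>"
    and \<nu>_eq_sum: "A \<in> sets \<mu> \<Longrightarrow> emeasure \<nu> A = (\<Sum>i\<in>{1..H}. emeasure (\<nu>s i) A)"
    and \<delta>_pos: "0 < \<delta>" and \<delta>_le_1: "\<delta> \<le> 1"
    and \<delta>_le_r\<^sub>0: "i \<in> {1..H} \<Longrightarrow> \<delta> \<le> r\<^sub>0 i"
    and \<delta>_separates: "i \<in> {1..H} \<Longrightarrow> j \<in> {1..H} \<Longrightarrow> i \<noteq> j \<Longrightarrow> y \<in> F i \<Longrightarrow> z \<in> F j \<Longrightarrow>
      2 * K * \<delta> \<le> d y z"
begin

abbreviation total :: "'a set" where "total \<equiv> \<Union>i\<in>{1..H}. F i"

definition U :: "nat \<Rightarrow> 'a set" where "U i = {x. qdist d x (F i) < ennreal \<delta>}"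

lemma space_\<nu> [simp]: "space \<nu> = UNIV"
  using sets_eq_imp_space_eq[OF sets_\<nu>] by simp

lemma openin_U: "openin (qtop d) (U i)"
  unfolding U_def by (rule openin_qdist_less)

lemma sets_U [measurable]: "U i \<in> sets \<mu>"
  by (rule sets_open[OF openin_U])

lemma subset_U: "F i \<subseteq> U i"
  using \<delta>_pos by (force simp: U_def qdist_less_ennreal_iff)

lemma disjoint_U: "disjoint_family_on U {1..H}"
  unfolding disjoint_family_on_def
proof (intro ballI impI)
  fix i j assume ij: "i \<in> {1..H}" "j \<in> {1..H}" "i \<noteq> j"
  show "U i \<inter> U j = {}"
  proof (rule ccontr)
    assume "U i \<inter> U j \<noteq> {}"
    then obtain x y z where yz: "y \<in> F i" "d x y < \<delta>" "z \<in> F j" "d x z < \<delta>"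
      unfolding U_def qdist_less_ennreal_iff by blast
    have "d y x < \<delta>" using yz(2) by (simp add: d_commute)
    from d_triangle_less[OF this yz(4)] show False
      using \<delta>_separates[OF ij yz(1,3)] by (simp add: algebra_simps)
  qed
qed

lemma U_unique: "i \<in> {1..H} \<Longrightarrow> j \<in> {1..H} \<Longrightarrow> x \<in> U i \<Longrightarrow> x \<in> U j \<Longrightarrow> i = j"
  using disjoint_U unfolding disjoint_family_on_def by blast

lemma piecewise_power_inside:
  assumes "i \<in> {1..H}" "x \<in> U i"
  shows "piecewise_power d H F U b x = epow (qdist d x (F i)) (b i)"
proof -
  have "piecewise_power d H F U b x
      = (\<Prod>j\<in>{1..H}. if j = i then epow (qdist d x (F i)) (b i) else 1)"
    unfolding piecewise_power_def using assms U_unique by (intro prod.cong) auto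
  also have "\<dots> = epow (qdist d x (F i)) (b i)" using assms by (subst prod.delta) auto
  finally show ?thesis .
qed

lemma piecewise_power_outside:
  "x \<notin> (\<Union>i\<in>{1..H}. U i) \<Longrightarrow> piecewise_power d H F U b x = 1"
  unfolding piecewise_power_def by (intro prod.neutral) auto

lemma inside_outside_cases:
  obtains (inside) i where "i \<in> {1..H}" "x \<in> U i" | (outside) "x \<notin> (\<Union>i\<in>{1..H}. U i)"
  by blast

lemma measurable_piecewise_power [measurable]: "piecewise_power d H F U b \<in> borel_measurable \<mu>"
  unfolding piecewise_power_def[abs_def] by measurable

lemma epow_inside_ge_1:
  assumes "x \<in> U i" "a \<le> 0"
  shows "1 \<le> epow (qdist d x (F i)) a"
proof -
  have "qdist d x (F i) < ennreal \<delta>" using assms by (simp add: U_def)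
  also have "\<dots> \<le> 1" using \<delta>_le_1 by (simp add: ennreal_le_1)
  finally have "epow 1 a \<le> epow (qdist d x (F i)) a" using assms by (intro epow_antimono) auto
  then show ?thesis by simp
qed

lemma epow_outside_le:
  assumes "x \<notin> U i" "a \<le> 0"
  shows "epow (qdist d x (F i)) a \<le> ennreal (\<delta> powr a)"
  unfolding epow_ennreal[OF \<delta>_pos, symmetric]
  using assms by (intro epow_antimono) (auto simp: U_def not_less)

subsection \<open>The weights\<close>

text \<open>Inside \<open>U\<^sub>i\<close> the weight equals \<open>\<rho>\<^sub>i\<^sup>b \<ge> 1\<close>, outside it \<open>\<rho>\<^sub>i\<^sup>b\<close> is at most \<open>\<delta>\<^sup>b\<close>; so the weight is comparable
to the maximum of the functions \<open>1 + \<rho>\<^sub>i\<^sup>b\<close>.\<close>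

lemma A1_minorant_piecewise_power:
  assumes b: "\<And>i. i \<in> {1..H} \<Longrightarrow> b i \<le> 0 \<and> - (\<alpha> - s i) < b i"
  shows "A1_minorant d \<mu> (piecewise_power d H F U b)"
proof -
  define L where "L = 2 + (\<Sum>i\<in>{1..H}. \<delta> powr b i)"
  have L: "2 \<le> L" "\<And>i. i \<in> {1..H} \<Longrightarrow> 1 + \<delta> powr b i \<le> L"
  proof -
    show "2 \<le> L" by (simp add: L_def sum_nonneg)
    fix i assume i: "i \<in> {1..H}"
    have "\<delta> powr b i \<le> (\<Sum>i\<in>{1..H}. \<delta> powr b i)" by (rule member_le_sum[OF i]) auto
    then show "1 + \<delta> powr b i \<le> L" by (simp add: L_def)
  qed
  have ge_1: "1 \<le> piecewise_power d H F U b x" for x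
  proof (cases x rule: inside_outside_cases)
    case (inside i)
    then show ?thesis using b by (simp add: piecewise_power_inside epow_inside_ge_1)
  qed (simp add: piecewise_power_outside)
  show ?thesis
  proof (rule A1_minorant_dominated[where I = "{1..H}" and L = L
        and w = "\<lambda>i x. 1 + epow (qdist d x (F i)) (b i)"])
    fix i assume i: "i \<in> {1..H}"
    interpret S: regular_subset d K \<alpha> \<mu> c "F i" "s i" "\<nu>s i" "k i" "r\<^sub>0 i" by (rule piece[OF i])
    show "A1_minorant d \<mu> (\<lambda>x. 1 + epow (qdist d x (F i)) (b i))"
      using b[OF i] by (intro S.A1_minorant_power) auto
  next
    fix x
    show "piecewise_power d H F U b x \<le> 1 + (\<Sum>i\<in>{1..H}. 1 + epow (qdist d x (F i)) (b i))"
    proof (cases x rule: inside_outside_cases)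
      case (inside i)
      have "epow (qdist d x (F i)) (b i) \<le> 1 + epow (qdist d x (F i)) (b i)" by simp
      also have "\<dots> \<le> (\<Sum>i\<in>{1..H}. 1 + epow (qdist d x (F i)) (b i))"
        by (rule member_le_sum[OF inside(1)]) auto
      also have "\<dots> \<le> 1 + \<dots>" by simp
      finally show ?thesis using inside by (simp add: piecewise_power_inside)
    qed (simp add: piecewise_power_outside)
  next
    fix i x assume i: "i \<in> {1..H}"
    show "1 + epow (qdist d x (F i)) (b i) \<le> ennreal L * piecewise_power d H F U b x"
    proof (cases "x \<in> U i")
      case True
      have "1 + epow (qdist d x (F i)) (b i) \<le> 2 * epow (qdist d x (F i)) (b i)"
        using epow_inside_ge_1[OF True, of "b i"] b[OF i] by (simp add: mult_2 add_right_mono)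
      also have "\<dots> \<le> ennreal L * epow (qdist d x (F i)) (b i)"
        using ennreal_leI[OF L(1)] by (intro mult_right_mono) auto
      finally show ?thesis using True i by (simp add: piecewise_power_inside)
    next
      case False
      have "1 + epow (qdist d x (F i)) (b i) \<le> 1 + ennreal (\<delta> powr b i)"
        using epow_outside_le[OF False, of "b i"] b[OF i] by (intro add_left_mono) auto
      also have "\<dots> = ennreal (1 + \<delta> powr b i)" by (simp add: ennreal_plus)
      also have "\<dots> \<le> ennreal L * 1" using ennreal_leI[OF L(2)[OF i]] by (simp only: mult_1_right)
      also have "\<dots> \<le> ennreal L * piecewise_power d H F U b x" by (intro mult_left_mono ge_1) simp
      finally show ?thesis .
    qed
  qed (use L ge_1 in auto)
qed

lemma muckenhoupt_Ap_piecewise_power: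
  assumes p: "1 < p" and \<beta>: "\<And>i. i \<in> {1..H} \<Longrightarrow> - (\<alpha> - s i) < \<beta> i \<and> \<beta> i < (\<alpha> - s i) * (p - 1)"
  shows "muckenhoupt_Ap p d \<mu> (piecewise_power d H F U \<beta>)"
proof -
  (* At each i at most one of b1, b2 is nonzero, so the two factors are never infinite together. *)
  define b1 where "b1 i = min (\<beta> i) 0" for i
  define b2 where "b2 i = min (- \<beta> i / (p - 1)) 0" for i
  have s: "s i < \<alpha>" if i: "i \<in> {1..H}" for i
  proof -
    interpret S: regular_subset d K \<alpha> \<mu> c "F i" "s i" "\<nu>s i" "k i" "r\<^sub>0 i" by (rule piece[OF i])
    show ?thesis by (rule S.s_less)
  qed
  have exps: "b1 i = \<beta> i \<and> b2 i = 0 \<or> b1 i = 0 \<and> b2 i * (1 - p) = \<beta> i \<and> b2 i = - \<beta> i / (p - 1)" for i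
  proof (cases "\<beta> i \<le> 0")
    case True
    then have "0 \<le> - \<beta> i / (p - 1)" using p by (intro divide_nonneg_nonneg) auto
    then show ?thesis using True by (simp add: b1_def b2_def)
  next
    case False
    then have "- \<beta> i / (p - 1) \<le> 0" using p by (intro divide_nonpos_nonneg) auto
    then have "b2 i = - \<beta> i / (p - 1)" unfolding b2_def by (rule min_absorb1)
    then show ?thesis using False p by (simp add: b1_def field_simps)
  qed
  have w1: "A1_minorant d \<mu> (piecewise_power d H F U b1)"
    using \<beta> s by (intro A1_minorant_piecewise_power) (auto simp: b1_def min_def)
  have w2: "A1_minorant d \<mu> (piecewise_power d H F U b2)"
  proof (rule A1_minorant_piecewise_power)
    fix i assume i: "i \<in> {1..H}"
    have "\<beta> i / (p - 1) < \<alpha> - s i" using \<beta>[OF i] p by (simp add: pos_divide_less_eq)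
    then show "b2 i \<le> 0 \<and> - (\<alpha> - s i) < b2 i" using s[OF i] by (auto simp: b2_def min_def)
  qed
  show ?thesis
  proof (rule A1_minorants_imp_Ap[OF p w1 w2])
    fix x
    show "piecewise_power d H F U \<beta> x \<le> piecewise_power d H F U b1 x * epow (piecewise_power d H F U b2 x) (1 - p)"
    proof (cases x rule: inside_outside_cases)
      case (inside i)
      show ?thesis
        unfolding piecewise_power_inside[OF inside] epow_epow using exps[of i] by auto
    qed (simp add: piecewise_power_outside)
    show "epow (piecewise_power d H F U \<beta> x) (- 1 / (p - 1))
        \<le> piecewise_power d H F U b2 x * epow (piecewise_power d H F U b1 x) (- 1 / (p - 1))"
    proof (cases x rule: inside_outside_cases)
      case (inside i)
      show ?thesis
        unfolding piecewise_power_inside[OF inside] epow_epow using exps[of i] by auto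
    qed (simp add: piecewise_power_outside)
  qed measurable
qed

subsection \<open>The maximal function of the sum\<close>

lemma \<nu>_total: "\<exists>T>0. \<forall>A. emeasure \<nu> A \<le> ennreal T"
proof -
  have "\<exists>T. 0 < T \<and> (\<forall>A. emeasure (\<nu>s i) A \<le> ennreal T)" if i: "i \<in> {1..H}" for i
  proof -
    interpret S: regular_subset d K \<alpha> \<mu> c "F i" "s i" "\<nu>s i" "k i" "r\<^sub>0 i" by (rule piece[OF i])
    show ?thesis using S.\<nu>_total by blast
  qed
  then have "\<forall>i\<in>{1..H}. \<exists>T. 0 < T \<and> (\<forall>A. emeasure (\<nu>s i) A \<le> ennreal T)" by blast
  from bchoice[OF this] obtain T where
    T: "\<And>i. i \<in> {1..H} \<Longrightarrow> 0 < T i" "\<And>i A. i \<in> {1..H} \<Longrightarrow> emeasure (\<nu>s i) A \<le> ennreal (T i)"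
    by blast
  have nonneg: "0 \<le> (\<Sum>i\<in>{1..H}. T i)" by (intro sum_nonneg less_imp_le T(1))
  have "emeasure \<nu> A \<le> ennreal ((\<Sum>i\<in>{1..H}. T i) + 1)" for A
  proof -
    have "emeasure \<nu> A \<le> emeasure \<nu> UNIV" using emeasure_space[of \<nu> A] by simp
    also have "\<dots> = (\<Sum>i\<in>{1..H}. emeasure (\<nu>s i) UNIV)"
      by (rule \<nu>_eq_sum) (use sets.top[of \<mu>] in simp)
    also have "\<dots> \<le> (\<Sum>i\<in>{1..H}. ennreal (T i))" by (intro sum_mono T(2))
    also have "\<dots> = ennreal (\<Sum>i\<in>{1..H}. T i)" by (rule sum_ennreal) (use T(1) in \<open>auto intro: less_imp_le\<close>)
    also have "\<dots> \<le> ennreal ((\<Sum>i\<in>{1..H}. T i) + 1)" by (intro ennreal_leI) simp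
    finally show ?thesis .
  qed
  then show ?thesis using nonneg by (intro exI[of _ "(\<Sum>i\<in>{1..H}. T i) + 1"]) auto
qed

lemma \<nu>_ball_eq_0:
  assumes "ennreal r \<le> qdist d x total"
  shows "emeasure \<nu> (qball d x r) = 0"
proof -
  have "emeasure (\<nu>s i) (qball d x r) = 0" if i: "i \<in> {1..H}" for i
  proof -
    interpret S: regular_subset d K \<alpha> \<mu> c "F i" "s i" "\<nu>s i" "k i" "r\<^sub>0 i" by (rule piece[OF i])
    have "qdist d x total \<le> qdist d x (F i)" unfolding qdist_def using i by (intro INF_superset_mono) auto
    then show ?thesis using assms by (intro S.\<nu>_ball_eq_0) (rule order_trans)
  qed
  then show ?thesis by (simp add: \<nu>_eq_sum)
qed

lemma \<nu>_UNIV_le: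
  assumes "total \<subseteq> qball d x r"
  shows "emeasure \<nu> UNIV \<le> emeasure \<nu> (qball d x r)"
proof -
  have "emeasure (\<nu>s i) UNIV \<le> emeasure (\<nu>s i) (qball d x r)" if i: "i \<in> {1..H}" for i
  proof -
    interpret S: regular_subset d K \<alpha> \<mu> c "F i" "s i" "\<nu>s i" "k i" "r\<^sub>0 i" by (rule piece[OF i])
    show ?thesis by (rule S.\<nu>_UNIV_le) (use i assms in blast)
  qed
  then have "(\<Sum>i\<in>{1..H}. emeasure (\<nu>s i) UNIV) \<le> (\<Sum>i\<in>{1..H}. emeasure (\<nu>s i) (qball d x r))"
    by (rule sum_mono)
  then show ?thesis using sets.top[of \<mu>] by (simp add: \<nu>_eq_sum)
qed

lemma maximal_fun_ge_mass:
  assumes "total \<noteq> {}"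
  shows "\<exists>a>0. \<forall>x r. 0 < r \<longrightarrow> total \<subseteq> qball d x r \<longrightarrow>
    ennreal (a * r powr (- \<alpha>)) \<le> maximal_fun d \<mu> \<nu> x"
proof -
  obtain i where i: "i \<in> {1..H}" "F i \<noteq> {}" using assms by blast
  interpret S: regular_subset d K \<alpha> \<mu> c "F i" "s i" "\<nu>s i" "k i" "r\<^sub>0 i" by (rule piece[OF i(1)])
  have "0 < emeasure (\<nu>s i) UNIV" by (rule S.\<nu>_pos[OF i(2)])
  also have "\<dots> \<le> (\<Sum>i\<in>{1..H}. emeasure (\<nu>s i) UNIV)" by (rule member_le_sum[OF i(1)]) auto
  also have "\<dots> = emeasure \<nu> UNIV" using sets.top[of \<mu>] by (simp add: \<nu>_eq_sum)
  finally obtain m where m: "0 < m" "ennreal m < emeasure \<nu> UNIV" using ennreal_between by blast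
  show ?thesis
  proof (intro exI[of _ "m / c"] conjI allI impI)
    show "0 < m / c" using m by simp
    fix x r assume r: "0 < r" "total \<subseteq> qball d x r"
    have "ennreal (m / (c * r powr \<alpha>)) \<le> maximal_fun d \<mu> \<nu> x"
      using m \<nu>_UNIV_le[OF r(2)] by (intro maximal_fun_ge r(1)) auto
    then show "ennreal (m / c * r powr (- \<alpha>)) \<le> maximal_fun d \<mu> \<nu> x"
      by (simp add: powr_minus field_simps)
  qed
qed

lemma total_diam:
  obtains \<Delta> where "0 \<le> \<Delta>" "qdiam d total = ennreal \<Delta>"
    "\<And>y z. y \<in> total \<Longrightarrow> z \<in> total \<Longrightarrow> d y z \<le> \<Delta>"
proof -
  fix p :: 'a
  have "\<exists>R. 0 < R \<and> F i \<subseteq> qball d p R" if i: "i \<in> {1..H}" for i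
  proof -
    interpret S: regular_subset d K \<alpha> \<mu> c "F i" "s i" "\<nu>s i" "k i" "r\<^sub>0 i" by (rule piece[OF i])
    show ?thesis using S.bounded_subset_ball by blast
  qed
  then have "\<forall>i\<in>{1..H}. \<exists>R. 0 < R \<and> F i \<subseteq> qball d p R" by blast
  from bchoice[OF this] obtain R where
    R: "\<And>i. i \<in> {1..H} \<Longrightarrow> 0 < R i" "\<And>i. i \<in> {1..H} \<Longrightarrow> F i \<subseteq> qball d p (R i)" by blast
  define R' where "R' = (\<Sum>i\<in>{1..H}. R i)"
  have near: "d p y < R'" if y: "y \<in> total" for y
  proof -
    obtain i where i: "i \<in> {1..H}" "y \<in> F i" using y by blast
    then have "d p y < R i" using R(2) by (auto simp: qball_def)
    also have "R i \<le> R'" unfolding R'_def by (rule member_le_sum[OF i(1)]) (use R(1) in \<open>auto intro: less_imp_le\<close>)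
    finally show ?thesis .
  qed
  have "qdiam d total \<le> ennreal (K * (R' + R'))"
    unfolding qdiam_def
  proof (intro SUP_least ennreal_leI)
    fix y z assume "y \<in> total" "z \<in> total"
    then have "d y p < R'" "d p z < R'" using near[of y] near[of z] d_commute[of y p] by simp_all
    then show "d y z \<le> K * (R' + R')" using d_triangle_less less_imp_le by blast
  qed
  then obtain \<Delta> where \<Delta>: "0 \<le> \<Delta>" "qdiam d total = ennreal \<Delta>"
    by (cases "qdiam d total") (auto simp: top_unique)
  moreover have "d y z \<le> \<Delta>" if "y \<in> total" "z \<in> total" for y z
  proof -
    have "ennreal (d y z) \<le> qdiam d total"
      unfolding qdiam_def by (rule order_trans[OF SUP_upper[OF that(2)] SUP_upper[OF that(1)]])
    then show ?thesis using \<Delta> by simp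
  qed
  ultimately show ?thesis by (rule that)
qed

text \<open>Stated for an arbitrary bound \<open>e\<close> so that it covers both regions: \<open>e = \<rho>\<^sub>i(x)\<^sup>s\<^sup>-\<^sup>\<alpha>\<close> for \<open>x\<close> in \<open>U\<^sub>i\<close>, and
\<open>e = 1\<close> outside all neighbourhoods. The pieces whose neighbourhood misses \<open>x\<close> contribute constants.\<close>

lemma maximal_fun_near_upper:
  "\<exists>C>0. \<forall>x e. 1 \<le> e \<longrightarrow> (\<forall>j\<in>{1..H}. x \<in> U j \<longrightarrow> epow (qdist d x (F j)) (s j - \<alpha>) \<le> e) \<longrightarrow>
    maximal_fun d \<mu> \<nu> x \<le> ennreal C * e"
proof -
  have "\<exists>C. 0 \<le> C \<and> (\<forall>x r. 0 < r \<longrightarrow> emeasure (\<nu>s i) (qball d x r)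
      \<le> ennreal C * (1 + epow (qdist d x (F i)) (s i - \<alpha>)) * emeasure \<mu> (qball d x r))"
    if i: "i \<in> {1..H}" for i
  proof -
    interpret S: regular_subset d K \<alpha> \<mu> c "F i" "s i" "\<nu>s i" "k i" "r\<^sub>0 i" by (rule piece[OF i])
    show ?thesis using S.\<nu>_ball_le by blast
  qed
  then have "\<forall>i\<in>{1..H}. \<exists>C. 0 \<le> C \<and> (\<forall>x r. 0 < r \<longrightarrow> emeasure (\<nu>s i) (qball d x r)
      \<le> ennreal C * (1 + epow (qdist d x (F i)) (s i - \<alpha>)) * emeasure \<mu> (qball d x r))" by blast
  from bchoice[OF this] obtain C where C: "\<And>i. i \<in> {1..H} \<Longrightarrow> 0 \<le> C i"
    and le: "\<And>i x r. i \<in> {1..H} \<Longrightarrow> 0 < r \<Longrightarrow> emeasure (\<nu>s i) (qball d x r)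
      \<le> ennreal (C i) * (1 + epow (qdist d x (F i)) (s i - \<alpha>)) * emeasure \<mu> (qball d x r)" by blast
  define g where "g j = 2 + \<delta> powr (s j - \<alpha>)" for j
  define C' where "C' = 1 + (\<Sum>i\<in>{1..H}. C i * g i)"
  have g: "0 \<le> g i" for i by (simp add: g_def)
  have sum_nonneg: "0 \<le> (\<Sum>i\<in>{1..H}. C i * g i)" using C g by (intro sum_nonneg mult_nonneg_nonneg) auto
  have "maximal_fun d \<mu> \<nu> x \<le> ennreal C' * e"
    if e: "1 \<le> e" and inside: "\<And>j. j \<in> {1..H} \<Longrightarrow> x \<in> U j \<Longrightarrow> epow (qdist d x (F j)) (s j - \<alpha>) \<le> e"
    for x e
  proof -
    have bound: "1 + epow (qdist d x (F i)) (s i - \<alpha>) \<le> ennreal (g i) * e" if i: "i \<in> {1..H}" for i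
    proof (cases "x \<in> U i")
      case True
      have "1 + epow (qdist d x (F i)) (s i - \<alpha>) \<le> e + e" by (intro add_mono e inside i True)
      also have "\<dots> = ennreal 2 * e" by (simp add: mult_2)
      also have "\<dots> \<le> ennreal (g i) * e" by (intro mult_right_mono ennreal_leI) (auto simp: g_def)
      finally show ?thesis .
    next
      case False
      interpret S: regular_subset d K \<alpha> \<mu> c "F i" "s i" "\<nu>s i" "k i" "r\<^sub>0 i" by (rule piece[OF i])
      have "1 + epow (qdist d x (F i)) (s i - \<alpha>) \<le> 1 + ennreal (\<delta> powr (s i - \<alpha>))"
        using S.s_less by (intro add_left_mono epow_outside_le False) auto
      also have "\<dots> = ennreal (1 + \<delta> powr (s i - \<alpha>))" by (simp add: ennreal_plus)
      also have "\<dots> \<le> ennreal (g i) * 1" by (simp add: g_def ennreal_leI)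
      also have "\<dots> \<le> ennreal (g i) * e" by (intro mult_left_mono e) simp
      finally show ?thesis .
    qed
    show ?thesis
    proof (rule maximal_fun_le)
      fix r :: real assume r: "0 < r"
      let ?m = "emeasure \<mu> (qball d x r)"
      have "emeasure \<nu> (qball d x r) = (\<Sum>i\<in>{1..H}. emeasure (\<nu>s i) (qball d x r))"
        by (rule \<nu>_eq_sum) simp
      also have "\<dots> \<le> (\<Sum>i\<in>{1..H}. ennreal (C i) * (ennreal (g i) * e) * ?m)"
        by (intro sum_mono order_trans[OF le[OF _ r]] mult_mono bound) auto
      also have "\<dots> = (\<Sum>i\<in>{1..H}. ennreal (C i * g i)) * e * ?m"
        unfolding sum_distrib_right using C g by (intro sum.cong) (auto simp: ennreal_mult mult.assoc)
      also have "(\<Sum>i\<in>{1..H}. ennreal (C i * g i)) = ennreal (\<Sum>i\<in>{1..H}. C i * g i)"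
        using C g by (intro sum_ennreal) auto
      also have "ennreal (\<Sum>i\<in>{1..H}. C i * g i) * e * ?m \<le> ennreal C' * e * ?m"
        by (intro mult_right_mono ennreal_leI) (auto simp: C'_def)
      finally show "emeasure \<nu> (qball d x r) \<le> ennreal C' * e * ?m" .
    qed
  qed
  moreover have "0 < C'" using sum_nonneg by (simp add: C'_def)
  ultimately show ?thesis by blast
qed

lemma maximal_fun_inside:
  assumes i: "i \<in> {1..H}"
  shows "comparable_on (U i - F i) (maximal_fun d \<mu> \<nu>) (\<lambda>x. epow (qdist d x (F i)) (s i - \<alpha>))"
proof -
  interpret S: regular_subset d K \<alpha> \<mu> c "F i" "s i" "\<nu>s i" "k i" "r\<^sub>0 i" by (rule piece[OF i])
  obtain C where C: "0 < C" and upper: "\<And>x e. 1 \<le> e \<Longrightarrow>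
      (\<forall>j\<in>{1..H}. x \<in> U j \<longrightarrow> epow (qdist d x (F j)) (s j - \<alpha>) \<le> e) \<Longrightarrow>
      maximal_fun d \<mu> \<nu> x \<le> ennreal C * e"
    using maximal_fun_near_upper by blast
  obtain q where q: "0 < q" and lower: "\<And>x. 0 < qdist d x (F i) \<Longrightarrow> qdist d x (F i) < ennreal (r\<^sub>0 i) \<Longrightarrow>
      ennreal q * epow (qdist d x (F i)) (s i - \<alpha>) \<le> maximal_fun d \<mu> (\<nu>s i) x"
    using S.maximal_fun_lower by blast
  have "ennreal q * epow (qdist d x (F i)) (s i - \<alpha>) \<le> maximal_fun d \<mu> \<nu> x \<and>
      maximal_fun d \<mu> \<nu> x \<le> ennreal C * epow (qdist d x (F i)) (s i - \<alpha>)" if x: "x \<in> U i - F i" for x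
  proof
    have "qdist d x (F i) < ennreal \<delta>" using x by (simp add: U_def)
    then have "qdist d x (F i) < ennreal (r\<^sub>0 i)" using ennreal_leI[OF \<delta>_le_r\<^sub>0[OF i]] by (rule less_le_trans)
    moreover have "0 < qdist d x (F i)" using qdist_pos[OF S.closed] x by blast
    ultimately have "ennreal q * epow (qdist d x (F i)) (s i - \<alpha>) \<le> maximal_fun d \<mu> (\<nu>s i) x"
      by (rule lower[rotated])
    also have "\<dots> \<le> maximal_fun d \<mu> \<nu> x"
    proof (rule maximal_fun_mono)
      fix x r
      have "emeasure (\<nu>s i) (qball d x r) \<le> (\<Sum>i\<in>{1..H}. emeasure (\<nu>s i) (qball d x r))"
        by (rule member_le_sum[OF i]) auto
      then show "emeasure (\<nu>s i) (qball d x r) \<le> emeasure \<nu> (qball d x r)" by (simp add: \<nu>_eq_sum)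
    qed
    finally show "ennreal q * epow (qdist d x (F i)) (s i - \<alpha>) \<le> maximal_fun d \<mu> \<nu> x" .
    show "maximal_fun d \<mu> \<nu> x \<le> ennreal C * epow (qdist d x (F i)) (s i - \<alpha>)"
    proof (rule upper)
      show "1 \<le> epow (qdist d x (F i)) (s i - \<alpha>)" using x S.s_less by (intro epow_inside_ge_1) auto
      show "\<forall>j\<in>{1..H}. x \<in> U j \<longrightarrow> epow (qdist d x (F j)) (s j - \<alpha>) \<le> epow (qdist d x (F i)) (s i - \<alpha>)"
        using U_unique[OF i] x by blast
    qed
  qed
  then show ?thesis unfolding comparable_on_def using C q by blast
qed

text \<open>Such points have distance at least \<open>\<delta>\<close> from every piece, and stay within a fixed distance of \<open>F\<close>, so
that a ball of one fixed radius around each of them contains all of \<open>F\<close>.\<close>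

lemma maximal_fun_outside:
  "comparable_on {x \<in> - (\<Union>i\<in>{1..H}. U i). qdist d x total < ennreal (2 * K) * qdiam d total}
    (maximal_fun d \<mu> \<nu>) (\<lambda>_. 1)"
proof (cases "total = {}")
  case True
  have "{x \<in> - (\<Union>i\<in>{1..H}. U i). qdist d x total < ennreal (2 * K) * qdiam d total} = {}"
    unfolding True by (simp add: qdiam_def bot_ennreal)
  then show ?thesis by (simp only: comparable_on_def) (auto intro!: exI[of _ "1::real"])
next
  case False
  obtain C where C: "0 < C" and upper: "\<And>x e. 1 \<le> e \<Longrightarrow>
      (\<forall>j\<in>{1..H}. x \<in> U j \<longrightarrow> epow (qdist d x (F j)) (s j - \<alpha>) \<le> e) \<Longrightarrow>
      maximal_fun d \<mu> \<nu> x \<le> ennreal C * e"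
    using maximal_fun_near_upper by blast
  obtain a where a: "0 < a" and lower: "\<And>x r. 0 < r \<Longrightarrow> total \<subseteq> qball d x r \<Longrightarrow>
      ennreal (a * r powr (- \<alpha>)) \<le> maximal_fun d \<mu> \<nu> x"
    using maximal_fun_ge_mass[OF False] by blast
  obtain \<Delta> where \<Delta>: "0 \<le> \<Delta>" "qdiam d total = ennreal \<Delta>"
    "\<And>y z. y \<in> total \<Longrightarrow> z \<in> total \<Longrightarrow> d y z \<le> \<Delta>" using total_diam by blast
  define R where "R = K * (2 * K * \<Delta> + (\<Delta> + 1))"
  have R: "0 < R" unfolding R_def using \<Delta> by (intro mult_pos_pos add_nonneg_pos) auto
  have "ennreal (a * R powr (- \<alpha>)) * 1 \<le> maximal_fun d \<mu> \<nu> x \<and> maximal_fun d \<mu> \<nu> x \<le> ennreal C * 1"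
    if x: "x \<notin> (\<Union>i\<in>{1..H}. U i)" "qdist d x total < ennreal (2 * K) * qdiam d total" for x
  proof
    have "qdist d x total < ennreal (2 * K * \<Delta>)" using x \<Delta> by (simp add: ennreal_mult)
    then obtain z where z: "z \<in> total" "d x z < 2 * K * \<Delta>" unfolding qdist_less_ennreal_iff by blast
    have "total \<subseteq> qball d z (\<Delta> + 1)"
    proof
      fix y assume "y \<in> total"
      from \<Delta>(3)[OF z(1) this] show "y \<in> qball d z (\<Delta> + 1)" by (simp add: qball_def)
    qed
    also have "\<dots> \<subseteq> qball d x R" by (rule qball_subset[OF z(2)]) (simp add: R_def)
    finally show "ennreal (a * R powr (- \<alpha>)) * 1 \<le> maximal_fun d \<mu> \<nu> x" using lower[OF R] by simp
    show "maximal_fun d \<mu> \<nu> x \<le> ennreal C * 1" using x(1) by (intro upper) auto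
  qed
  then show ?thesis
    unfolding comparable_on_def using C a R
    by (intro exI[of _ "a * R powr (- \<alpha>)"] conjI exI[of _ C]) auto
qed

text \<open>A point of \<open>F\<close> at distance less than \<open>t\<close> from \<open>x\<close> exists, and \<open>diam F \<le> d(x, F) / (2K) < t\<close>. This is the
reason for the threshold \<open>2K diam F\<close>: beyond it all points of \<open>F\<close> are about equally far from \<open>x\<close>.\<close>

lemma far_ball:
  assumes x: "ennreal (2 * K) * qdiam d total \<le> qdist d x total" and t: "qdist d x total < ennreal t"
    and y: "y \<in> total"
  shows "d x y < 2 * K * t"
proof -
  obtain \<Delta> where \<Delta>: "0 \<le> \<Delta>" "qdiam d total = ennreal \<Delta>"
    "\<And>y z. y \<in> total \<Longrightarrow> z \<in> total \<Longrightarrow> d y z \<le> \<Delta>" using total_diam by blast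
  obtain z where z: "z \<in> total" "d x z < t" using t unfolding qdist_less_ennreal_iff by blast
  have "ennreal (2 * K * \<Delta>) < ennreal t" using x t \<Delta> by (simp add: ennreal_mult order_le_less_trans)
  then have "2 * K * \<Delta> < t" using \<Delta> by (simp add: ennreal_less_iff)
  moreover have "\<Delta> \<le> K * \<Delta>" by (rule K_mult_ge[OF \<Delta>(1)])
  ultimately have "d z y < t" using \<Delta>(3)[OF z(1) y] \<Delta>(1) by linarith
  from d_triangle_less[OF z(2) this] show ?thesis by simp
qed

text \<open>The case \<open>d(x, F) = 0\<close> occurs when \<open>F\<close> is the single point \<open>x\<close>; then balls of arbitrarily small
radius contain \<open>F\<close>, and both sides are infinite. Otherwise a ball around \<open>x\<close> with positive
\<open>\<nu>\<close>-mass has radius larger than \<open>d(x, F)\<close>, while the radius \<open>4K d(x, F)\<close> already captures the whole mass.\<close>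

lemma maximal_fun_far:
  "comparable_on {x. ennreal (2 * K) * qdiam d total \<le> qdist d x total}
    (maximal_fun d \<mu> \<nu>) (\<lambda>x. epow (qdist d x total) (- \<alpha>))"
proof (cases "total = {}")
  case True
  have "maximal_fun d \<mu> \<nu> x \<le> 0" for x
  proof (rule maximal_fun_le)
    show "emeasure \<nu> (qball d x r) \<le> 0 * emeasure \<mu> (qball d x r)" for r
      using \<nu>_ball_eq_0[of r x] unfolding True by simp
  qed
  then show ?thesis unfolding comparable_on_def True
    using \<alpha>_pos by (auto simp: epow_top_neg intro!: exI[of _ "1::real"])
next
  case False
  obtain a where a: "0 < a" and lower: "\<And>x r. 0 < r \<Longrightarrow> total \<subseteq> qball d x r \<Longrightarrow>
      ennreal (a * r powr (- \<alpha>)) \<le> maximal_fun d \<mu> \<nu> x"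
    using maximal_fun_ge_mass[OF False] by blast
  obtain T where T: "0 < T" "\<And>A. emeasure \<nu> A \<le> ennreal T" using \<nu>_total by blast
  define q where "q = a * (4 * K) powr (- \<alpha>)"
  have q: "0 < q" using a by (simp add: q_def)
  have "ennreal q * epow (qdist d x total) (- \<alpha>) \<le> maximal_fun d \<mu> \<nu> x \<and>
      maximal_fun d \<mu> \<nu> x \<le> ennreal (T * c) * epow (qdist d x total) (- \<alpha>)"
    if x: "ennreal (2 * K) * qdiam d total \<le> qdist d x total" for x
  proof -
    have ge: "ennreal (a * (2 * K * t) powr (- \<alpha>)) \<le> maximal_fun d \<mu> \<nu> x"
      if t: "0 < t" "qdist d x total < ennreal t" for t
    proof (rule lower)
      show "0 < 2 * K * t" using t by simp
      show "total \<subseteq> qball d x (2 * K * t)" using far_ball[OF x t(2)] by (auto simp: qball_def)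
    qed
    show ?thesis
    proof (cases "qdist d x total" rule: ennreal_trichotomy)
      case 1
      have "maximal_fun d \<mu> \<nu> x = top"
      proof (rule ennreal_eq_topI)
        fix r :: real
        define r' where "r' = max r 1"
        define t where "t = (r' / a) powr (- 1 / \<alpha>) / (2 * K)"
        have r': "0 < r'" "r \<le> r'" by (auto simp: r'_def)
        have t: "0 < t" using r' a by (simp add: t_def)
        have "2 * K * t = (r' / a) powr (- 1 / \<alpha>)" by (simp add: t_def)
        then have "a * (2 * K * t) powr (- \<alpha>) = r'"
          using r' a \<alpha>_pos by (simp add: powr_powr)
        then show "ennreal r \<le> maximal_fun d \<mu> \<nu> x"
          using ge[OF t] 1 t r'(2) by (auto intro: order_trans[OF ennreal_leI])
      qed
      then show ?thesis using 1 T \<alpha>_pos by (simp add: epow_0_neg ennreal_mult_top)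
    next
      case (2 e)
      have "q * e powr (- \<alpha>) = a * (2 * K * (2 * e)) powr (- \<alpha>)"
        using 2(1) by (simp add: q_def powr_mult mult_ac)
      then have "ennreal q * epow (qdist d x total) (- \<alpha>) \<le> maximal_fun d \<mu> \<nu> x"
        using ge[of "2 * e"] 2 q by (simp add: epow_ennreal ennreal_mult[symmetric] ennreal_less_iff)
      moreover have "maximal_fun d \<mu> \<nu> x \<le> ennreal (T * c) * epow (qdist d x total) (- \<alpha>)"
      proof (rule maximal_fun_le)
        fix r :: real assume r: "0 < r"
        let ?e = "ennreal (T * c) * epow (qdist d x total) (- \<alpha>)"
        show "emeasure \<nu> (qball d x r) \<le> ?e * emeasure \<mu> (qball d x r)"
        proof (cases "r \<le> e")
          case True
          then show ?thesis using 2 by (simp add: \<nu>_ball_eq_0 ennreal_leI)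
        next
          case False
          obtain z where z: "z \<in> total" using \<open>total \<noteq> {}\<close> by blast
          have "ennreal e \<le> ennreal (d x z)" using qdist_le[OF z, of x] 2 by simp
          also have "\<dots> \<le> qdiam d UNIV"
            unfolding qdiam_def by (rule order_trans[OF SUP_upper SUP_upper[of x]]) auto
          finally have "ennreal (e powr \<alpha> / c) \<le> emeasure \<mu> (qball d x e)"
            by (rule \<mu>_ball_lower[OF 2(1)])
          also have "\<dots> \<le> emeasure \<mu> (qball d x r)"
            using False by (intro emeasure_mono qball_mono) auto
          finally have \<mu>_ge: "ennreal (e powr \<alpha> / c) \<le> emeasure \<mu> (qball d x r)" .
          have "emeasure \<nu> (qball d x r) \<le> ennreal T" by (rule T(2))
          also have "T = T * c * e powr (- \<alpha>) * (e powr \<alpha> / c)"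
            using 2(1) by (simp add: powr_minus)
          also have "ennreal \<dots> = ?e * ennreal (e powr \<alpha> / c)"
            unfolding 2(2) epow_ennreal[OF 2(1)] by (rule ennreal_mult3) (use T in auto)
          also have "\<dots> \<le> ?e * emeasure \<mu> (qball d x r)" by (intro mult_left_mono \<mu>_ge) simp
          finally show ?thesis .
        qed
      qed
      ultimately show ?thesis by blast
    next
      case 3
      then show ?thesis using qdist_finite[OF False, of x] by simp
    qed
  qed
  then show ?thesis
    unfolding comparable_on_def using q T
    by (intro exI[of _ q] conjI exI[of _ "T * c"]) auto
qed

lemma distance_far:
  "comparable_on ({x. ennreal (2 * K) * qdiam d total \<le> qdist d x total} \<times> total)
    (\<lambda>(x, x0). epow (qdist d x total) (- \<alpha>)) (\<lambda>(x, x0). epow (ennreal (d x x0)) (- \<alpha>))"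
proof -
  have "epow (ennreal (d x y)) (- \<alpha>) \<le> epow (qdist d x total) (- \<alpha>) \<and>
      epow (qdist d x total) (- \<alpha>) \<le> ennreal ((2 * K) powr \<alpha>) * epow (ennreal (d x y)) (- \<alpha>)"
    if x: "ennreal (2 * K) * qdiam d total \<le> qdist d x total" and y: "y \<in> total" for x y
  proof
    show "epow (ennreal (d x y)) (- \<alpha>) \<le> epow (qdist d x total) (- \<alpha>)"
      using \<alpha>_pos by (intro epow_antimono qdist_le[OF y]) simp
    obtain e where e: "qdist d x total = ennreal e" "0 \<le> e"
      using qdist_finite[of total x] y by (cases "qdist d x total") auto
    have "d x y / (2 * K) \<le> t" if "e < t" for t
      using far_ball[OF x _ y, of t] that e by (simp add: ennreal_less_iff field_simps)
    then have "d x y / (2 * K) \<le> e" by (rule dense_ge)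
    show "epow (qdist d x total) (- \<alpha>) \<le> ennreal ((2 * K) powr \<alpha>) * epow (ennreal (d x y)) (- \<alpha>)"
    proof (cases "d x y = 0")
      case True
      then show ?thesis using \<alpha>_pos by (simp add: epow_0_neg ennreal_mult_top)
    next
      case False
      then have pos: "0 < d x y" using d_nonneg[of x y] by linarith
      have "epow (qdist d x total) (- \<alpha>) \<le> epow (ennreal (d x y / (2 * K))) (- \<alpha>)"
        using \<alpha>_pos e \<open>d x y / (2 * K) \<le> e\<close> by (intro epow_antimono) (auto intro: ennreal_leI)
      also have "\<dots> = ennreal ((d x y / (2 * K)) powr (- \<alpha>))" using pos by (intro epow_ennreal) simp
      also have "(d x y / (2 * K)) powr (- \<alpha>) = (2 * K) powr \<alpha> * d x y powr (- \<alpha>)"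
        unfolding powr_divide by (simp add: powr_minus divide_inverse)
      also have "ennreal \<dots> = ennreal ((2 * K) powr \<alpha>) * epow (ennreal (d x y)) (- \<alpha>)"
        using pos by (simp add: epow_ennreal ennreal_mult)
      finally show ?thesis .
    qed
  qed
  then show ?thesis
    unfolding comparable_on_def
    by (intro exI[of _ 1] conjI exI[of _ "(2 * K) powr \<alpha>"]) auto
qed

end

section \<open>Choosing the neighbourhoods\<close>

lemma comparable_on_subset: "comparable_on S f g \<Longrightarrow> T \<subseteq> S \<Longrightarrow> comparable_on T f g"
  unfolding comparable_on_def by blast

lemma at_right_0_witness:
  assumes "eventually P (at_right (0::real))"
  shows "\<exists>t>0. P t"
proof -
  obtain b where "0 < b" "\<And>y. 0 < y \<Longrightarrow> y < b \<Longrightarrow> P y"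
    using assms unfolding eventually_at_right_field by blast
  then show ?thesis by (intro exI[of _ "b / 2"]) auto
qed

lemma eventually_le_at_right_0: "0 < (b::real) \<Longrightarrow> eventually (\<lambda>t. t \<le> b) (at_right 0)"
  unfolding eventually_at_right_field by (intro exI[of _ b]) auto

theorem theorem6:
  fixes d :: "'a \<Rightarrow> 'a \<Rightarrow> real" and K \<alpha> :: real and \<mu> \<nu> :: "'a measure"
    and H :: nat and F :: "nat \<Rightarrow> 'a set" and s :: "nat \<Rightarrow> real" and \<nu>s :: "nat \<Rightarrow> 'a measure"
  defines "F\<^sub>U \<equiv> \<Union>i\<in>{1..H}. F i"
  assumes "quasi_metric K d"
    and "\<And>x r. openin (qtop d) (qball d x r)"
    and "ahlfors d UNIV \<alpha> \<mu>"
    and "nonatomic_homogeneous d \<mu>"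
    and "disjoint_family_on F {1..H}"
    and "\<And>i. i \<in> {1..H} \<Longrightarrow> closedin (qtop d) (F i)"
    and "\<And>i. i \<in> {1..H} \<Longrightarrow> qdiam d (F i) < \<infinity>"
    and separated: "\<And>i j. i \<in> {1..H} \<Longrightarrow> j \<in> {1..H} \<Longrightarrow> i \<noteq> j \<Longrightarrow> 0 < (INF x\<in>F i. qdist d x (F j))"
    and "\<And>i. i \<in> {1..H} \<Longrightarrow> 0 \<le> s i \<and> s i < \<alpha>"
    and "\<And>i. i \<in> {1..H} \<Longrightarrow> locally_ahlfors d (F i) (s i) (\<nu>s i)"
    and "sets \<nu> = sets \<mu>"
    and "\<And>A. A \<in> sets \<mu> \<Longrightarrow> emeasure \<nu> A = (\<Sum>i\<in>{1..H}. emeasure (\<nu>s i) A)"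
  shows "\<exists>U :: nat \<Rightarrow> 'a set.
    (\<forall>i\<in>{1..H}. openin (qtop d) (U i) \<and> F i \<subseteq> U i) \<and> disjoint_family_on U {1..H} \<and>
    (\<forall>i\<in>{1..H}. comparable_on {x \<in> U i - F i. qdist d x F\<^sub>U < ennreal (2 * K) * qdiam d F\<^sub>U}
        (maximal_fun d \<mu> \<nu>) (\<lambda>x. epow (qdist d x (F i)) (s i - \<alpha>))) \<and>
    comparable_on {x \<in> - (\<Union>i\<in>{1..H}. U i). qdist d x F\<^sub>U < ennreal (2 * K) * qdiam d F\<^sub>U}
        (maximal_fun d \<mu> \<nu>) (\<lambda>_. 1) \<and>
    comparable_on {x. qdist d x F\<^sub>U \<ge> ennreal (2 * K) * qdiam d F\<^sub>U}
        (maximal_fun d \<mu> \<nu>) (\<lambda>x. epow (qdist d x F\<^sub>U) (- \<alpha>)) \<and>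
    comparable_on ({x. qdist d x F\<^sub>U \<ge> ennreal (2 * K) * qdiam d F\<^sub>U} \<times> F\<^sub>U)
        (\<lambda>(x, x0). epow (qdist d x F\<^sub>U) (- \<alpha>)) (\<lambda>(x, x0). epow (ennreal (d x x0)) (- \<alpha>)) \<and>
    (\<forall>\<gamma>. 0 \<le> \<gamma> \<and> \<gamma> < 1 \<longrightarrow>
        muckenhoupt_A1 d \<mu> (piecewise_power d H F U (\<lambda>i. (s i - \<alpha>) * \<gamma>))) \<and>
    (\<forall>p \<beta>. 1 < p \<and> (\<forall>i\<in>{1..H}. - (\<alpha> - s i) < \<beta> i \<and> \<beta> i < (\<alpha> - s i) * (p - 1)) \<longrightarrow>
        muckenhoupt_Ap p d \<mu> (piecewise_power d H F U \<beta>))"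
proof -
  obtain c where "ahlfors_regular d K \<alpha> \<mu> c"
    using ahlfors_regularI assms(2-5) by blast
  then interpret X: ahlfors_regular d K \<alpha> \<mu> c .
  have "\<exists>p. regular_subset d K \<alpha> \<mu> c (F i) (s i) (\<nu>s i) (fst p) (snd p)" if i: "i \<in> {1..H}" for i
  proof -
    obtain r\<^sub>0 k where "0 < r\<^sub>0" "1 \<le> k" and "borel_measure_finite_on_balls d (\<nu>s i)"
      and "AE x in \<nu>s i. x \<in> F i"
      and "\<forall>x\<in>F i. \<forall>r>0. r < r\<^sub>0 \<longrightarrow>
        ennreal (r powr s i / k) \<le> emeasure (\<nu>s i) (qball d x r) \<and>
        emeasure (\<nu>s i) (qball d x r) \<le> ennreal (k * r powr s i)"
      using assms(11)[OF i] unfolding locally_ahlfors_def by blast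
    then have "regular_subset d K \<alpha> \<mu> c (F i) (s i) (\<nu>s i) k r\<^sub>0"
      using assms(7,8,10)[OF i] by unfold_locales auto
    then show ?thesis by (intro exI[of _ "(k, r\<^sub>0)"]) simp
  qed
  then have "\<forall>i\<in>{1..H}. \<exists>p. regular_subset d K \<alpha> \<mu> c (F i) (s i) (\<nu>s i) (fst p) (snd p)" by blast
  from bchoice[OF this] obtain p where
    piece: "\<And>i. i \<in> {1..H} \<Longrightarrow> regular_subset d K \<alpha> \<mu> c (F i) (s i) (\<nu>s i) (fst (p i)) (snd (p i))"
    by blast
  have r\<^sub>0: "0 < snd (p i)" if "i \<in> {1..H}" for i
  proof -
    interpret S: regular_subset d K \<alpha> \<mu> c "F i" "s i" "\<nu>s i" "fst (p i)" "snd (p i)"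
      by (rule piece[OF that])
    show ?thesis by (rule S.r\<^sub>0_pos)
  qed
  (* There are finitely many requirements on the width, each satisfied by all small positive numbers,
     so the filter of right neighbourhoods of 0 combines them. *)
  have sep: "eventually (\<lambda>\<delta>. i \<noteq> j \<longrightarrow> (\<forall>y\<in>F i. \<forall>z\<in>F j. 2 * K * \<delta> \<le> d y z)) (at_right 0)"
    if ij: "i \<in> {1..H}" "j \<in> {1..H}" for i j
  proof (cases "i = j")
    case False
    obtain b where b: "0 < b" "ennreal b < (INF x\<in>F i. qdist d x (F j))"
      using ennreal_between[OF separated[OF ij False]] by blast
    have b_le: "b \<le> d y z" if "y \<in> F i" "z \<in> F j" for y z
    proof -
      note b(2)
      also have "(INF x\<in>F i. qdist d x (F j)) \<le> qdist d y (F j)" by (rule INF_lower[OF that(1)])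
      also have "\<dots> \<le> ennreal (d y z)" by (rule X.qdist_le[OF that(2)])
      finally show ?thesis using b(1) by (simp add: ennreal_less_iff)
    qed
    have "eventually (\<lambda>\<delta>. \<delta> \<le> b / (2 * K)) (at_right 0)"
      using b(1) by (intro eventually_le_at_right_0) simp
    then show ?thesis
    proof eventually_elim
      case (elim \<delta>)
      then have "2 * K * \<delta> \<le> b" by (simp add: field_simps)
      then show ?case using b_le by (meson order_trans)
    qed
  qed simp
  have "eventually (\<lambda>\<delta>. \<delta> \<le> 1 \<and> (\<forall>i\<in>{1..H}. \<delta> \<le> snd (p i)) \<and>
      (\<forall>i\<in>{1..H}. \<forall>j\<in>{1..H}. i \<noteq> j \<longrightarrow> (\<forall>y\<in>F i. \<forall>z\<in>F j. 2 * K * \<delta> \<le> d y z))) (at_right 0)"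
    by (intro eventually_conj eventually_le_at_right_0 eventually_ball_finite ballI sep r\<^sub>0) auto
  from at_right_0_witness[OF this] obtain \<delta> where \<delta>: "0 < \<delta>" "\<delta> \<le> 1"
    "\<And>i. i \<in> {1..H} \<Longrightarrow> \<delta> \<le> snd (p i)"
    "\<And>i j y z. i \<in> {1..H} \<Longrightarrow> j \<in> {1..H} \<Longrightarrow> i \<noteq> j \<Longrightarrow> y \<in> F i \<Longrightarrow> z \<in> F j \<Longrightarrow> 2 * K * \<delta> \<le> d y z"
    by blast
  interpret Y: regular_family d K \<alpha> \<mu> c H F s \<nu>s \<nu> "\<lambda>i. fst (p i)" "\<lambda>i. snd (p i)" \<delta>
    by (intro regular_family.intro regular_family_axioms.intro X.ahlfors_regular_axioms
        piece assms(12,13) \<delta>)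
  show ?thesis
    unfolding F\<^sub>U_def
  proof (intro exI[of _ Y.U] conjI ballI allI impI)
    show "comparable_on {x \<in> Y.U i - F i. qdist d x Y.total < ennreal (2 * K) * qdiam d Y.total}
        (maximal_fun d \<mu> \<nu>) (\<lambda>x. epow (qdist d x (F i)) (s i - \<alpha>))" if "i \<in> {1..H}" for i
      by (rule comparable_on_subset[OF Y.maximal_fun_inside[OF that]]) auto
    show "muckenhoupt_A1 d \<mu> (piecewise_power d H F Y.U (\<lambda>i. (s i - \<alpha>) * \<gamma>))"
      if "0 \<le> \<gamma> \<and> \<gamma> < 1" for \<gamma>
    proof (intro X.A1_minorant_imp_A1 Y.A1_minorant_piecewise_power conjI)
      fix i assume "i \<in> {1..H}"
      then have "s i < \<alpha>" using assms(10) by blast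
      then show "(s i - \<alpha>) * \<gamma> \<le> 0" "- (\<alpha> - s i) < (s i - \<alpha>) * \<gamma>"
        using that by (auto simp: mult_le_0_iff mult_less_cancel_left1)
    qed
    show "muckenhoupt_Ap p d \<mu> (piecewise_power d H F Y.U \<beta>)"
      if "1 < p \<and> (\<forall>i\<in>{1..H}. - (\<alpha> - s i) < \<beta> i \<and> \<beta> i < (\<alpha> - s i) * (p - 1))" for p \<beta>
      using that by (intro Y.muckenhoupt_Ap_piecewise_power) auto
  qed (use Y.openin_U Y.subset_U Y.disjoint_U Y.maximal_fun_outside Y.maximal_fun_far Y.distance_far in auto)
qed

end
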